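(* There exists $c>0$ such that for every $N$ large enough, every $Q\in[cN/\sqrt{\log N},\,20N]$ and every sequence of complex numbers $(\varphi_n)_{1\le n\le N}$, we have $$\sum_{1<q/Q\le 2}\ \sum_{a\,\mathrm{mod}^*q}|S(\varphi,a/q)|^2\ \ge\ Q^2e^{-cN/Q}\sum_{m}|\varphi_m|^2 .$$
   Context: $e(x)=\exp(2\pi i x)$ and $S(\varphi,\alpha)=\sum_{1\le n\le N}\varphi_n e(n\alpha)$. The variable $q$ runs over positive integers, and $a\,\mathrm{mod}^*q$ means that $a$ runs over the reduced residue classes modulo $q$. *)

theory Defs
  imports "HOL-Analysis.Analysis" "HOL-Number_Theory.Totient"
begin

definition e :: "real \<Rightarrow> complex" where
  "e x = exp (2 * of_real pi * \<i> * of_real x)"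

text \<open>Only the values \<open>\<phi> 1, \<dots>, \<phi> N\<close> matter: a total function
  \<open>nat \<Rightarrow> complex\<close> encodes the finite sequence.\<close>

definition S :: "nat \<Rightarrow> (nat \<Rightarrow> complex) \<Rightarrow> real \<Rightarrow> complex" where
  "S N \<phi> \<alpha> = (\<Sum>n=1..N. \<phi> n * e (real n * \<alpha>))"

end

theory Submission imports Defs "HOL-Real_Asymp.Real_Asymp" begin

text \<open>Write \<open>f = S N \<phi>\<close>. Since \<open>f\<close> has frequencies at most \<open>N\<close>, on an interval of length about
\<open>1/Q\<close> it behaves like a polynomial of degree \<open>n\<close>, where \<open>n\<close> is a large constant times \<open>N/Q\<close>. A
polynomial of degree below \<open>n\<close> is controlled on the whole interval by its values at \<open>n\<close>
well-spaced nodes, at the price of a Lebesgue constant exponential in \<open>n\<close>: this is the source of the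
factor \<open>exp (- c N / Q)\<close>. The theorem is thus a discrete version of the inequality of Logvinenko and
Sereda, in which the sampling set consists of fractions.

Three ingredients carry the argument.

Interpolation with a Taylor error. Expand \<open>f\<close> at the left end of an interval of length \<open>1/m\<close>. The
square of the remainder is at most a tiny constant times the mean square of the \<open>n\<close>-th derivative over
that same interval, so after summation over all \<open>m\<close> intervals Parseval's identity bounds the total error
by \<open>(2 pi N / m) ^ (2 n) / ((n - 1)!)\<^sup>2\<close> times the total mass. This remains
small after multiplication by the square of the exponential Lebesgue constant as soon as \<open>n\<close> exceeds
a large multiple of \<open>N/Q\<close>. Taking each node where \<open>|f|\<close> is smallest among at least \<open>T\<close> available
fractions replaces the values at the nodes by averages and yields \<open>sampling_inequality\<close>.

Distribution of fractions. Each interval of length \<open>8/Q\<close> must contain an interval of length \<open>1/(2 Q)\<close>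
that is filled, down to scale \<open>1/(n Q)\<close>, with fractions of denominators in \<open>(Q, 2 Q]\<close>, to within a
power of \<open>n\<close> of the expected number. Large gaps occur only around a fraction \<open>a/b\<close> with small \<open>b\<close>. If there
is such a fraction with \<open>b \<le> 32 n\<close>, the explicit fractions \<open>a/b + 1/(b\<^sup>2 r)\<close> to the right of it suffice
(\<open>farey_shell_near_rational\<close>). If there is none, walk from one fraction with denominator at
most \<open>Q\<close> to the next: all steps are short, and each gap contains its fair share of fractions
(\<open>farey_shell_dense\<close>). Both cases are combined in \<open>farey_shell_well_distributed\<close>.

Size of \<open>Q\<close>. Powers of \<open>n\<close> are absorbed by \<open>exp (c N / Q)\<close>, because \<open>N/Q \<ge> 1/20\<close>; and the counting
of fractions needs \<open>Q\<close> to exceed a multiple of \<open>n ^ 3\<close>, which holds because \<open>N/Q\<close> is at most of the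
order of \<open>sqrt (ln N)\<close>.\<close>

section \<open>Fractions with denominators in a dyadic range\<close>

text \<open>The fractions live on the real line rather than modulo 1, so that neighbourhoods of integers need
no special treatment; only at the end is the set cut down to \<open>{0..<1}\<close>.\<close>
definition farey_shell :: "real \<Rightarrow> real set" where
  "farey_shell Q = {x. \<exists>a q :: int. coprime a q \<and> Q < real_of_int q \<and> real_of_int q \<le> 2 * Q \<and>
      x = real_of_int a / real_of_int q}"

lemma finite_farey_shell:
  assumes "Q \<ge> 0"
  shows "finite (farey_shell Q \<inter> {l..r})"
proof -
  define M where "M = \<lceil>2 * Q * (\<bar>l\<bar> + \<bar>r\<bar>)\<rceil>"
  have "farey_shell Q \<inter> {l..r} \<subseteq> (\<lambda>(a, q). of_int a / of_int q) ` ({-M..M} \<times> {0..\<lfloor>2 * Q\<rfloor>})"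
  proof
    fix x assume x: "x \<in> farey_shell Q \<inter> {l..r}"
    then obtain a q :: int where q: "Q < real_of_int q" "real_of_int q \<le> 2 * Q" "x = a / q"
      by (auto simp: farey_shell_def)
    have "q > 0" using q assms by linarith
    have "\<bar>real_of_int a\<bar> = q * \<bar>x\<bar>"
      using \<open>q > 0\<close> q by (simp add: abs_mult)
    also have "\<dots> \<le> 2 * Q * (\<bar>l\<bar> + \<bar>r\<bar>)"
      using x q \<open>q > 0\<close> assms by (intro mult_mono) auto
    also have "\<dots> \<le> M" unfolding M_def by linarith
    finally have "\<bar>a\<bar> \<le> M" by linarith
    moreover have "q \<le> \<lfloor>2 * Q\<rfloor>" using q by linarith
    ultimately show "x \<in> (\<lambda>(a, q). of_int a / of_int q) ` ({-M..M} \<times> {0..\<lfloor>2 * Q\<rfloor>})"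
      using q \<open>q > 0\<close> by (intro image_eqI[of _ _ "(a, q)"]) auto
  qed
  then show ?thesis by (rule finite_subset) auto
qed

lemma coprime_if_det_unit:
  fixes a b a' b' :: int
  assumes "a' * b - a * b' = 1 \<or> a' * b - a * b' = - 1"
  shows "coprime a' b'"
proof (rule coprimeI)
  fix d assume "d dvd a'" "d dvd b'"
  then have "d dvd a' * b - a * b'" by auto
  then show "is_unit d" using assms by auto
qed

text \<open>The mediants \<open>(a' + k a)/(b' + k b)\<close> with \<open>k = 1, 2, \<dots>\<close> move from \<open>a'/b'\<close> towards \<open>a/b\<close>. The first has
denominator \<open>b + b' > Q\<close>, and the denominators stay below \<open>2 Q\<close> for at least \<open>Q/b\<close> rounded down steps.
Since \<open>b'\<close> is of size \<open>Q\<close>, that number is comparable to \<open>Q\<^sup>2\<close> times the gap \<open>1/(b b')\<close>. The sign of the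
determinant is left open, and betweenness is written as a product, so that one statement covers
both orders of the two fractions.\<close>
lemma farey_gap_count_aux:
  fixes a b a' b' :: int and Q :: real
  assumes Q: "Q > 0" and b: "b \<ge> 1" "b \<le> Q" and b': "b' \<ge> 1" "b' \<le> Q"
    and sum: "b + b' > Q" and large: "2 * b' \<ge> Q"
    and det: "a' * b - a * b' = D" and D: "D = 1 \<or> D = -1"
  shows "card (farey_shell Q \<inter> {x. (x - a / b) * (a' / b' - x) > 0}) \<ge> Q\<^sup>2 / 4 * (1 / (b * b'))"
proof -
  define m where "m = nat \<lfloor>Q / b\<rfloor>"
  define p where "p k = (a' + int k * a) / (b' + int k * b)" for k :: nat
  have den: "b' + int k * b > 0" for k using b b' by (simp add: add_pos_nonneg)
  have detR: "real_of_int a' * b - a * b' = D" using det by (metis of_int_diff of_int_mult)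
  have diff1: "p k - a / b = D / (b * (b' + int k * b))" for k
  proof -
    have "real_of_int (b' + int k * b) > 0" using den[of k] by linarith
    then show ?thesis
      using b unfolding p_def detR[symmetric] by (simp add: field_simps)
  qed
  have diff2: "a' / b' - p k = real k * real_of_int D / (b' * (b' + int k * b))" for k
  proof -
    have "real_of_int (b' + int k * b) > 0" using den[of k] by linarith
    then show ?thesis
      using b' unfolding p_def detR[symmetric] by (simp add: field_simps)
  qed
  have inj: "inj_on p {1..m}"
  proof (rule inj_onI)
    fix j k assume "p j = p k"
    then have "D / (b * (b' + int j * b)) = D / (b * (b' + int k * b))"
      using diff1 by metis
    then have "real_of_int (b * (b' + int j * b)) = b * (b' + int k * b)"
      using D b den[of j] den[of k] by (auto simp: field_simps)
    then have "b * (b' + int j * b) = b * (b' + int k * b)" by linarith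
    then show "j = k" using b by simp
  qed
  have sub: "p ` {1..m} \<subseteq> farey_shell Q \<inter> {x. (x - a / b) * (a' / b' - x) > 0}"
  proof (clarify, intro IntI)
    fix k assume k: "k \<in> {1..m}"
    have "(a' + int k * a) * b - a * (b' + int k * b) = D"
      using det by (simp add: algebra_simps)
    then have cop: "coprime (a' + int k * a) (b' + int k * b)"
      using D by (intro coprime_if_det_unit[where a = a and b = b]) auto
    have "real k \<le> Q / b"
      using k b Q unfolding m_def by (simp add: le_nat_iff le_floor_iff)
    then have "real k * b \<le> Q" using b by (simp add: field_simps)
    then have le: "real_of_int (b' + int k * b) \<le> 2 * Q" using b' by simp
    have "b \<le> int k * b" using k b by simp
    then have gt: "real_of_int (b' + int k * b) > Q" using sum by linarith
    show "p k \<in> farey_shell Q"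
      unfolding farey_shell_def p_def using cop le gt by blast
    have "(p k - a / b) * (a' / b' - p k) = D * D * k / (b * b' * (b' + int k * b)\<^sup>2)"
      unfolding diff1 diff2 by (simp add: power2_eq_square mult_ac)
    also have "\<dots> > 0"
    proof (intro divide_pos_pos)
      have "real_of_int (b' + int k * b) > 0" using den[of k] by linarith
      then show "0 < real_of_int (b * b' * (b' + int k * b)\<^sup>2)"
        using b b' unfolding of_int_mult of_int_power by (intro mult_pos_pos zero_less_power) auto
    qed (use D k in auto)
    finally show "p k \<in> {x. (x - a / b) * (a' / b' - x) > 0}" by simp
  qed
  have fin: "finite (farey_shell Q \<inter> {x. (x - a / b) * (a' / b' - x) > 0})"
  proof (rule finite_subset)
    show "farey_shell Q \<inter> {x. (x - a / b) * (a' / b' - x) > 0}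
        \<subseteq> farey_shell Q \<inter> {min (a / b) (a' / b') .. max (a / b) (a' / b')}"
      by (auto simp: zero_less_mult_iff min_def max_def)
  qed (use Q finite_farey_shell in auto)
  have Qb: "Q / b \<ge> 1" using b by (simp add: field_simps)
  have "Q\<^sup>2 / 4 * (1 / (b * b')) = (Q / b) / 2 * (Q / (2 * b'))"
    by (simp add: power2_eq_square)
  also have "\<dots> \<le> (Q / b) / 2 * 1"
    using large b' Q b by (intro mult_left_mono) auto
  also have "\<dots> \<le> m"
  proof -
    have "z / 2 * 1 \<le> \<lfloor>z\<rfloor>" if "z \<ge> 1" for z :: real
    proof -
      have "real_of_int \<lfloor>z\<rfloor> \<ge> 1" using that by simp
      then show ?thesis by linarith
    qed
    from this[OF Qb] show ?thesis unfolding m_def by linarith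
  qed
  also have "real m = card (p ` {1..m})" using inj by (simp add: card_image)
  also have "\<dots> \<le> card (farey_shell Q \<inter> {x. (x - a / b) * (a' / b' - x) > 0})"
    using card_mono[OF fin sub] by simp
  finally show ?thesis .
qed

text \<open>One of \<open>b\<close>, \<open>b'\<close> is at least \<open>Q/2\<close>; the mediants are taken towards the fraction with the other
denominator.\<close>
lemma farey_gap_count:
  fixes a b a' b' :: int and Q :: real
  assumes Q: "Q > 0" and b: "b \<ge> 1" "b \<le> Q" and b': "b' \<ge> 1" "b' \<le> Q"
    and sum: "b + b' > Q" and det: "a' * b - a * b' = 1"
  shows "card (farey_shell Q \<inter> {a / b<..<a' / b'}) \<ge> Q\<^sup>2 / 4 * (a' / b' - a / b)"
proof -
  have gap: "a' / b' - a / b = 1 / (b * b')"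
  proof -
    have "real_of_int a' * b - a * b' = 1" using det by (metis of_int_diff of_int_mult of_int_1)
    then show ?thesis using b b' by (simp add: field_simps)
  qed
  have "1 / (real_of_int b * b') > 0" using b b' by simp
  then have less: "a / b < real_of_int a' / b'" unfolding of_int_mult[symmetric] gap[symmetric] by linarith
  have eq: "{x. (x - a / b) * (a' / b' - x) > 0} = {a / b<..<a' / b'}"
    "{x. (x - a' / b') * (a / b - x) > 0} = {a / b<..<a' / b'}"
    using less by (auto simp: zero_less_mult_iff)
  show ?thesis
  proof (cases "2 * b' \<ge> Q")
    case True
    then show ?thesis
      using farey_gap_count_aux[of Q b b' a' a 1] assms eq gap by simp
  next
    case False
    then have "2 * b \<ge> Q" using sum by linarith
    then show ?thesis
      using farey_gap_count_aux[of Q b' b a a' "-1"] assms eq gap by (simp add: mult.commute)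
  qed
qed

text \<open>The solutions of \<open>a' b - a b' = 1\<close> form one residue class of \<open>b'\<close> modulo \<open>b\<close>, which meets the
interval \<open>(Q - b, Q]\<close>.\<close>
lemma farey_successor:
  fixes a b :: int and Q :: real
  assumes "coprime a b" "b \<ge> 1" "b \<le> Q"
  obtains a' b' :: int where "a' * b - a * b' = 1" "b' \<ge> 1" "b' \<le> Q" "b + b' > Q"
proof -
  obtain u v where uv: "u * a + v * b = 1"
    using bezout_int[of a b] assms by auto
  define t where "t = \<lfloor>(Q + u) / b\<rfloor>"
  have "t \<le> (Q + u) / b" "(Q + u) / b < t + 1" unfolding t_def by linarith+
  then have t: "t * b \<le> Q + u" "Q + u < t * b + b"
    using assms by (simp_all add: field_simps)
  show ?thesis
  proof
    show "(v + t * a) * b - a * (t * b - u) = 1" using uv by (simp add: algebra_simps)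
    show "t * b - u \<le> Q" "b + (t * b - u) > Q" using t by simp_all
    then show "t * b - u \<ge> 1" using assms by linarith
  qed
qed

text \<open>Iterating the successor from an integer to the left of \<open>l\<close> gives a sequence with all the properties of
consecutive fractions in the Farey sequence of order \<open>Q\<close> that the counting is based on.\<close>
lemma farey_walk:
  fixes Q :: real
  assumes Q: "Q \<ge> 1"
  obtains a b :: "nat \<Rightarrow> int" where "a 0 / b 0 < l"
    and "\<And>n. b n \<ge> 1" and "\<And>n. b n \<le> Q" and "\<And>n. b n + b (Suc n) > Q"
    and "\<And>n. a (Suc n) * b n - a n * b (Suc n) = 1"
proof -
  define P where "P n s \<longleftrightarrow> coprime (fst s) (snd s) \<and> snd s \<ge> 1 \<and> snd s \<le> Q \<and>
      (n = 0 \<longrightarrow> s = (\<lceil>l\<rceil> - 1, 1))" for n :: nat and s :: "int \<times> int"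
  define R where "R s s' \<longleftrightarrow> fst s' * snd s - fst s * snd s' = 1 \<and> snd s + snd s' > Q"
    for s s' :: "int \<times> int"
  have "\<exists>s. \<forall>n. P n (s n) \<and> R (s n) (s (Suc n))"
  proof (rule dependent_nat_choice)
    show "\<exists>s. P 0 s" using Q unfolding P_def by (intro exI[of _ "(\<lceil>l\<rceil> - 1, 1)"]) auto
  next
    fix s n assume "P n s"
    then obtain a' b' :: int where
      *: "a' * snd s - fst s * b' = 1" "b' \<ge> 1" "b' \<le> Q" "snd s + b' > Q"
      using farey_successor[of "fst s" "snd s" Q] unfolding P_def by blast
    have "coprime a' b'" using coprime_if_det_unit[of a' "snd s" "fst s" b'] * by blast
    then show "\<exists>s'. P (Suc n) s' \<and> R s s'"
      using * unfolding P_def R_def by (intro exI[of _ "(a', b')"]) auto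
  qed
  then obtain s where s: "\<And>n. P n (s n)" "\<And>n. R (s n) (s (Suc n))" by blast
  show ?thesis
  proof (rule that[of "fst \<circ> s" "snd \<circ> s"])
    show "(fst \<circ> s) 0 / (snd \<circ> s) 0 < l" using s(1)[of 0] unfolding P_def by simp linarith
  qed (use s in \<open>auto simp: P_def R_def\<close>)
qed

text \<open>A step of the walk from denominator \<open>b\<close> to \<open>b'\<close> has length \<open>1/(b b')\<close>, which is at most \<open>2/(B Q)\<close> when
both denominators exceed \<open>B\<close>, because one of them is at least \<open>Q/2\<close>. Hence the part of the walk inside
\<open>[l, r]\<close> misses at most \<open>2/(B Q)\<close> at either end, and on this part the gap counts add up. The margin
\<open>2/Q\<close> bounds any step at all, and therefore ensures that the steps that cross \<open>l\<close> and \<open>r\<close> also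
start and end in the region without small denominators.\<close>
lemma farey_shell_dense:
  fixes Q B l r :: real
  assumes Q: "Q \<ge> 1" and B: "B > 0"
    and sparse: "\<And>(a::int) (b::int). 1 \<le> b \<Longrightarrow> b \<le> B \<Longrightarrow> a / b \<notin> {l - 2 / Q..r + 2 / Q}"
  shows "card (farey_shell Q \<inter> {l..r}) \<ge> Q\<^sup>2 / 4 * (r - l - 4 / (B * Q))"
proof (cases "r - l \<le> 4 / (B * Q)")
  case True
  then have "Q\<^sup>2 / 4 * (r - l - 4 / (B * Q)) \<le> 0" by (intro mult_nonneg_nonpos) auto
  then show ?thesis by linarith
next
  case False
  obtain a b :: "nat \<Rightarrow> int" where start: "a 0 / b 0 < l"
    and b1: "\<And>n. b n \<ge> 1" and bQ: "\<And>n. b n \<le> Q" and sum: "\<And>n. b n + b (Suc n) > Q"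
    and det: "\<And>n. a (Suc n) * b n - a n * b (Suc n) = 1"
    using farey_walk[OF Q] by blast
  define x where "x n = a n / b n" for n
  have gap: "x (Suc n) - x n = 1 / (b n * b (Suc n))" for n
  proof -
    have "real_of_int (a (Suc n)) * b n - a n * b (Suc n) = 1"
      using det by (metis of_int_diff of_int_mult of_int_1)
    then show ?thesis using b1[of n] b1[of "Suc n"] unfolding x_def by (simp add: field_simps)
  qed
  have b1': "real_of_int (b n) \<ge> 1" "b n \<ge> 0" for n using b1[of n] by simp_all
  have x_Suc: "x (Suc n) \<ge> x n + 1 / Q\<^sup>2" for n
  proof -
    have "real_of_int (b n) * b (Suc n) \<le> Q * Q"
      using b1' bQ Q by (intro mult_mono) auto
    then have "1 / Q\<^sup>2 \<le> 1 / (b n * b (Suc n))"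
      using b1'[of n] b1'[of "Suc n"] Q unfolding power2_eq_square
      by (intro divide_left_mono mult_pos_pos) auto
    then show ?thesis using gap[of n] by linarith
  qed
  have incseq_x: "incseq x"
  proof (rule incseq_SucI)
    fix n
    have "1 / Q\<^sup>2 \<ge> 0" by simp
    then show "x n \<le> x (Suc n)" using x_Suc[of n] by linarith
  qed
  have lower: "x n \<ge> x 0 + n * (1 / Q\<^sup>2)" for n
  proof (induction n)
    case (Suc n) then show ?case using x_Suc[of n] by (simp add: algebra_simps add_divide_distrib)
  qed simp
  have unbounded: "\<exists>n. x n > z" for z
  proof -
    obtain n where "real n > (z - x 0) * Q\<^sup>2" using reals_Archimedean2 by blast
    then have "n * (1 / Q\<^sup>2) > z - x 0" using Q by (simp add: field_simps)
    then show ?thesis using lower[of n] by (intro exI[of _ n]) linarith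
  qed
  have prod_ge: "real_of_int (b n) * b (Suc n) \<ge> Q / 2 * c"
    if "c \<le> b n" "c \<le> b (Suc n)" "c \<ge> 0" for n and c :: real
  proof (cases "b n \<ge> Q / 2")
    case True
    then show ?thesis using that Q by (intro mult_mono) auto
  next
    case False
    then have "b (Suc n) \<ge> Q / 2" using sum[of n] by linarith
    then have "c * (Q / 2) \<le> real_of_int (b n) * b (Suc n)"
      using that Q by (intro mult_mono) auto
    then show ?thesis by (simp add: mult.commute)
  qed
  have gap_le: "x (Suc n) - x n \<le> 2 / (c * Q)"
    if "c \<le> b n" "c \<le> b (Suc n)" "c > 0" for n and c :: real
  proof -
    have "1 / (b n * b (Suc n)) \<le> 1 / (Q / 2 * c)"
      using prod_ge[of c n] that Q b1'[of n] b1'[of "Suc n"]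
      by (intro divide_left_mono mult_pos_pos) auto
    then show ?thesis using gap[of n] by (simp add: mult.commute)
  qed
  have gap_le_1: "x (Suc n) - x n \<le> 2 / Q" for n
    using gap_le[of 1 n] b1' by simp
  have zone: "b n > B" if "x n \<in> {l - 2 / Q..r + 2 / Q}" for n
    using sparse[of "b n" "a n"] b1[of n] that unfolding x_def by force
  have count: "card (farey_shell Q \<inter> {x i<..<x j}) \<ge> Q\<^sup>2 / 4 * (x j - x i)" if "i \<le> j" for i j
    using that
  proof (induction j rule: dec_induct)
    case (step j)
    have fin: "finite (farey_shell Q \<inter> {u<..<v})" for u v
      by (rule finite_subset[OF _ finite_farey_shell[of Q u v]]) (use Q in auto)
    have mono: "x i \<le> x j" "x j \<le> x (Suc j)"
      using incseq_x \<open>i \<le> j\<close> by (auto simp: incseq_def)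
    have "Q\<^sup>2 / 4 * (x (Suc j) - x i) = Q\<^sup>2 / 4 * (x j - x i) + Q\<^sup>2 / 4 * (x (Suc j) - x j)"
      by (simp flip: distrib_left)
    also have "\<dots> \<le> card (farey_shell Q \<inter> {x i<..<x j}) + card (farey_shell Q \<inter> {x j<..<x (Suc j)})"
      using step.IH farey_gap_count[of Q "b j" "b (Suc j)" "a (Suc j)" "a j"] Q b1 bQ sum[of j] det[of j]
      unfolding x_def of_nat_add by (intro add_mono) auto
    also have "\<dots> = card ((farey_shell Q \<inter> {x i<..<x j}) \<union> (farey_shell Q \<inter> {x j<..<x (Suc j)}))"
      using fin by (subst card_Un_disjoint) auto
    also have "\<dots> \<le> card (farey_shell Q \<inter> {x i<..<x (Suc j)})"
      using fin mono by (intro of_nat_mono card_mono) auto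
    finally show ?case .
  qed simp
  \<comment> \<open>The first vertices of the walk beyond \<open>l\<close> and beyond \<open>r\<close>; the last vertex not beyond \<open>r\<close> is \<open>j'\<close>.\<close>
  define i where "i = (LEAST n. x n \<ge> l)"
  define j where "j = (LEAST n. x n > r)"
  have "\<exists>n. x n \<ge> l" using unbounded[of l] less_imp_le by blast
  then have i: "x i \<ge> l" unfolding i_def by (rule LeastI_ex)
  have j: "x j > r" unfolding j_def by (rule LeastI_ex[OF unbounded])
  have lr: "l < r"
  proof -
    have "4 / (B * Q) > 0" using B Q by simp
    then show ?thesis using False by linarith
  qed
  obtain i' where i': "i = Suc i'"
    using i start not0_implies_Suc[of i] unfolding x_def by force
  obtain j' where j': "j = Suc j'"
    using j start lr not0_implies_Suc[of j] unfolding x_def by force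
  have i'l: "x i' < l" using not_less_Least[of i' "\<lambda>n. x n \<ge> l"] i' unfolding i_def by force
  have j'r: "x j' \<le> r" using not_less_Least[of j' "\<lambda>n. x n > r"] j' unfolding j_def by force
  have "2 / Q > 0" using Q by simp
  have "x i - x i' \<le> 2 / (B * Q)"
    unfolding i' using zone[of i'] zone[of "Suc i'"] i'l i i' lr gap_le_1[of i'] \<open>2 / Q > 0\<close> B
    by (intro gap_le) auto
  have "x j' > l"
  proof (rule ccontr)
    assume "\<not> l < x j'"
    then have "b j' > B" "b j > B"
      using zone[of j'] zone[of j] j j' lr gap_le_1[of j'] \<open>2 / Q > 0\<close> by auto
    then have "x j - x j' \<le> 2 / (B * Q)" unfolding j' using B by (intro gap_le) auto
    moreover have "2 / (B * Q) \<le> 4 / (B * Q)" using B Q by (intro divide_right_mono) auto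
    ultimately show False using False j \<open>\<not> l < x j'\<close> by linarith
  qed
  have "x j - x j' \<le> 2 / (B * Q)"
    unfolding j' using zone[of j'] zone[of "Suc j'"] j'r j j' lr gap_le_1[of j'] \<open>2 / Q > 0\<close> B \<open>x j' > l\<close>
    by (intro gap_le) auto
  have "i \<le> j'" unfolding i_def using \<open>x j' > l\<close> by (intro Least_le) simp
  have "r - l - 4 / (B * Q) \<le> x j' - x i"
    using \<open>x j - x j' \<le> 2 / (B * Q)\<close> \<open>x i - x i' \<le> 2 / (B * Q)\<close> i'l j by simp
  then have "Q\<^sup>2 / 4 * (r - l - 4 / (B * Q)) \<le> Q\<^sup>2 / 4 * (x j' - x i)"
    by (intro mult_left_mono) auto
  also have "\<dots> \<le> card (farey_shell Q \<inter> {x i<..<x j'})" using count[OF \<open>i \<le> j'\<close>] .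
  also have "\<dots> \<le> card (farey_shell Q \<inter> {l..r})"
    using i j'r Q by (intro of_nat_mono card_mono finite_farey_shell) auto
  finally show ?thesis .
qed

text \<open>The fraction \<open>a/b + 1/q\<close> has denominator exactly \<open>q\<close> whenever \<open>b\<^sup>2\<close> divides \<open>q\<close>, and for \<open>q\<close> in \<open>(Q, 2 Q]\<close>
these fractions cover the distances from \<open>1/(2 Q)\<close> to \<open>1/Q\<close>. The restriction to multiples of
\<open>b\<^sup>2\<close> costs a factor \<open>b\<^sup>2\<close>, which is harmless when \<open>b\<close> is small.\<close>
lemma farey_shell_near_rational:
  fixes a b :: int and Q \<alpha> w :: real
  assumes Q: "Q \<ge> 1" and b: "b \<ge> 1" and \<alpha>: "1 / (2 * Q) \<le> \<alpha>" and w: "w \<ge> 0" "\<alpha> + w \<le> 1 / Q"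
  shows "card (farey_shell Q \<inter> {a / b + \<alpha>..a / b + \<alpha> + w}) \<ge> w * Q\<^sup>2 / b\<^sup>2 - 1"
proof -
  have "1 / (2 * Q) > 0" using Q by simp
  then have \<alpha>0: "\<alpha> > 0" using \<alpha> by linarith
  have b0: "real_of_int b > 0" using b by simp
  define u where "u = 1 / (b\<^sup>2 * (\<alpha> + w))"
  define v where "v = 1 / (b\<^sup>2 * \<alpha>)"
  \<comment> \<open>The numbers \<open>r\<close> below satisfy \<open>u < r \<le> v\<close>. The strict inequality is needed for \<open>b\<^sup>2 r > Q\<close> when
    \<open>\<alpha> + w = 1/Q\<close>.\<close>
  define p where "p r = a / b + 1 / (b\<^sup>2 * r)" for r :: int
  have "u > 0" unfolding u_def using b0 \<alpha>0 w by simp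
  have sub: "p ` {\<lfloor>u\<rfloor><..\<lfloor>v\<rfloor>} \<subseteq> farey_shell Q \<inter> {a / b + \<alpha>..a / b + \<alpha> + w}"
  proof (clarify, intro IntI)
    fix r assume r: "r \<in> {\<lfloor>u\<rfloor><..\<lfloor>v\<rfloor>}"
    have uv: "u < r" "r \<le> v" using r by (auto simp: floor_less_iff le_floor_iff)
    have r0: "real_of_int r > 0" using uv \<open>u > 0\<close> by linarith
    have lo: "1 / (\<alpha> + w) < b\<^sup>2 * r" 
    proof -
      have "1 / (\<alpha> + w) = u * b\<^sup>2" using b0 \<alpha>0 w unfolding u_def by (simp add: divide_simps)
      also have "\<dots> < r * b\<^sup>2" using mult_strict_right_mono[OF uv(1), of "b\<^sup>2"] b0 by simp
      finally show ?thesis by (simp add: mult.commute)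
    qed
    have hi: "b\<^sup>2 * r \<le> 1 / \<alpha>" 
    proof -
      have "r * b\<^sup>2 \<le> v * b\<^sup>2" using mult_right_mono[OF uv(2), of "b\<^sup>2"] by simp
      also have "\<dots> = 1 / \<alpha>" using b0 \<alpha>0 unfolding v_def by simp
      finally show ?thesis by (simp add: mult.commute)
    qed
    have pos: "real_of_int b ^ 2 * r > 0" using b0 r0 by simp
    have "Q \<le> 1 / (\<alpha> + w)" using w \<alpha>0 Q by (simp add: field_simps)
    then have gtQ: "Q < b\<^sup>2 * r" using lo by linarith
    have "1 / \<alpha> \<le> 2 * Q" using \<alpha> \<alpha>0 Q by (simp add: field_simps)
    then have leQ: "b\<^sup>2 * r \<le> 2 * Q" using hi by linarith
    have "coprime (a * b * r + 1) (b\<^sup>2 * r)"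
    proof (rule coprimeI)
      fix d assume d: "d dvd a * b * r + 1" "d dvd b\<^sup>2 * r"
      \<comment> \<open>A prime that divides \<open>b\<^sup>2 r\<close> divides \<open>a b r\<close>; the combination below avoids primes.\<close>
      have "d dvd (1 - a * b * r) * (a * b * r + 1) + a\<^sup>2 * r * (b\<^sup>2 * r)"
        using d by (metis dvd_add dvd_mult)
      also have "\<dots> = 1" by (simp add: algebra_simps power2_eq_square)
      finally show "is_unit d" .
    qed
    moreover have "p r = (a * b * r + 1) / (b\<^sup>2 * r)"
      unfolding p_def using b0 r0 by (simp add: field_simps power2_eq_square)
    ultimately show "p r \<in> farey_shell Q"
      unfolding farey_shell_def using gtQ leQ
      by (intro CollectI exI[of _ "a * b * r + 1"] exI[of _ "b\<^sup>2 * r"]) simp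
    have "1 / (b\<^sup>2 * r) \<le> \<alpha> + w" using lo pos \<alpha>0 w by (simp add: field_simps)
    moreover have "1 / (b\<^sup>2 * r) \<ge> \<alpha>" using hi pos \<alpha>0 by (simp add: field_simps)
    ultimately show "p r \<in> {a / b + \<alpha>..a / b + \<alpha> + w}" unfolding p_def by simp
  qed
  have inj: "inj_on p {\<lfloor>u\<rfloor><..\<lfloor>v\<rfloor>}"
  proof (rule inj_onI)
    fix r s assume "r \<in> {\<lfloor>u\<rfloor><..\<lfloor>v\<rfloor>}" "s \<in> {\<lfloor>u\<rfloor><..\<lfloor>v\<rfloor>}" "p r = p s"
    moreover have "\<lfloor>u\<rfloor> \<ge> 0" using \<open>u > 0\<close> by simp
    ultimately show "r = s" using b0 unfolding p_def by (auto simp: field_simps)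
  qed
  have "w * Q\<^sup>2 / b\<^sup>2 \<le> w * (1 / (\<alpha> * (\<alpha> + w))) / b\<^sup>2"
  proof -
    have "\<alpha> * (\<alpha> + w) \<le> (1 / Q) * (1 / Q)" using w \<alpha>0 Q by (intro mult_mono) auto
    then have "1 / ((1 / Q) * (1 / Q)) \<le> 1 / (\<alpha> * (\<alpha> + w))"
      using \<alpha>0 w Q by (intro divide_left_mono mult_pos_pos) auto
    then have "Q\<^sup>2 \<le> 1 / (\<alpha> * (\<alpha> + w))" by (simp add: power2_eq_square)
    then show ?thesis using w by (intro divide_right_mono mult_left_mono) auto
  qed
  also have "w * (1 / (\<alpha> * (\<alpha> + w))) = 1 / \<alpha> - 1 / (\<alpha> + w)"
    using \<alpha>0 w by (simp add: divide_simps)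
  also have "\<dots> / b\<^sup>2 = v - u" unfolding u_def v_def by (simp add: diff_divide_distrib mult.commute)
  finally have "w * Q\<^sup>2 / b\<^sup>2 - 1 \<le> v - u - 1" by simp
  also have "\<dots> \<le> of_int (\<lfloor>v\<rfloor> - \<lfloor>u\<rfloor>)" by linarith
  also have "\<dots> \<le> card {\<lfloor>u\<rfloor><..\<lfloor>v\<rfloor>}" by simp
  also have "\<dots> = card (p ` {\<lfloor>u\<rfloor><..\<lfloor>v\<rfloor>})" using inj by (simp add: card_image)
  also have "\<dots> \<le> card (farey_shell Q \<inter> {a / b + \<alpha>..a / b + \<alpha> + w})"
    using sub Q by (intro of_nat_mono card_mono finite_farey_shell) auto
  finally show ?thesis .
qed

text \<open>With the threshold \<open>32 n\<close> for small denominators, the two ends lost in \<open>farey_shell_dense\<close> amount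
to \<open>4/(32 n Q)\<close>, which is half the length \<open>1/(4 n Q)\<close> of a piece. Pieces of this length are chosen because
\<open>2 n\<close> of them fit into an interval of length \<open>1/(2 Q)\<close>, and taking every other one separates the nodes.\<close>
lemma farey_shell_well_distributed:
  fixes Q t h :: real and n :: nat
  assumes n: "n \<ge> 1" and Q: "Q \<ge> 2 ^ 13 * real n ^ 3" and h: "h \<ge> 8 / Q"
  obtains y where "t \<le> y" "y + 1 / (2 * Q) < t + h"
    "\<And>z. y \<le> z \<Longrightarrow> z + 1 / (4 * n * Q) \<le> y + 1 / (2 * Q) \<Longrightarrow>
       card (farey_shell Q \<inter> {z..z + 1 / (4 * n * Q)}) \<ge> Q / (2 ^ 13 * real n ^ 3)"
proof -
  have n1: "real n ^ 3 \<ge> 1" using n by simp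
  have Q1: "Q \<ge> 1" using Q n1 by simp
  define w where "w = 1 / (4 * n * Q)"
  have w: "w \<ge> 0" "w \<le> 1 / (4 * Q)"
    using Q1 n unfolding w_def by (auto simp: field_simps)
  have half: "1 / Q = 1 / (2 * Q) + 1 / (2 * Q)" "8 / Q = 8 * (1 / Q)" "7 / Q = 7 * (1 / Q)"
    "2 / Q = 2 * (1 / Q)" "1 / (4 * Q) = 1 / Q / 4"
    using Q1 by (simp_all add: field_simps)
  have "1 / Q > 0" using Q1 by simp
  show ?thesis
  proof (cases "\<exists>(a::int) (b::int). 1 \<le> b \<and> b \<le> 32 * int n \<and> a / b \<in> {t..<t + 7 / Q}")
    case True
    then obtain a b :: int where b: "1 \<le> b" "b \<le> 32 * int n" and ab: "a / b \<in> {t..<t + 7 / Q}" by blast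
    show ?thesis
    proof (rule that[of "a / b + 1 / (2 * Q)"])
      show "t \<le> a / b + 1 / (2 * Q)" using ab half \<open>1 / Q > 0\<close> unfolding atLeastLessThan_iff by linarith
      show "a / b + 1 / (2 * Q) + 1 / (2 * Q) < t + h" using ab half h unfolding atLeastLessThan_iff by linarith
      fix z assume z: "a / b + 1 / (2 * Q) \<le> z"
        "z + 1 / (4 * n * Q) \<le> a / b + 1 / (2 * Q) + 1 / (2 * Q)"
      have b2: "real_of_int b ^ 2 \<le> (32 * real n) ^ 2"
        using b by (intro power_mono) linarith+
      have "Q / (2 ^ 13 * real n ^ 3) \<ge> 1" using Q n1 n by (subst le_divide_eq_1_pos) auto
      then have "Q / (2 ^ 13 * real n ^ 3) + 1 \<le> 2 * (Q / (2 ^ 13 * real n ^ 3))" by linarith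
      also have "\<dots> = w * Q\<^sup>2 / (32 * real n) ^ 2"
        unfolding w_def using n Q1 by (simp add: field_simps power2_eq_square power3_eq_cube)
      also have "\<dots> \<le> w * Q\<^sup>2 / b\<^sup>2"
        using b2 b w n by (intro divide_left_mono) (auto intro!: mult_pos_pos)
      finally have "Q / (2 ^ 13 * real n ^ 3) \<le> w * Q\<^sup>2 / b\<^sup>2 - 1" by simp
      also have "\<dots> \<le> card (farey_shell Q \<inter> {a / b + (z - a / b)..a / b + (z - a / b) + w})"
        using z w b Q1 half unfolding w_def[symmetric]
        by (intro farey_shell_near_rational) linarith+
      finally show "card (farey_shell Q \<inter> {z..z + 1 / (4 * n * Q)}) \<ge> Q / (2 ^ 13 * real n ^ 3)"
        unfolding w_def by simp
    qed
  next
    case False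
    show ?thesis
    proof (rule that[of "t + 2 / Q"])
      show "t \<le> t + 2 / Q" using half \<open>1 / Q > 0\<close> by linarith
      show "t + 2 / Q + 1 / (2 * Q) < t + h" using half \<open>1 / Q > 0\<close> h by linarith
      fix z assume z: "t + 2 / Q \<le> z" "z + 1 / (4 * n * Q) \<le> t + 2 / Q + 1 / (2 * Q)"
      have "real n \<le> real n ^ 3" using n by (intro self_le_power) auto
      then have "Q / (2 ^ 13 * real n ^ 3) \<le> Q / (32 * real n)"
        using n Q1 by (intro divide_left_mono mult_mono mult_pos_pos) auto
      also have "\<dots> = Q\<^sup>2 / 4 * (w - 4 / (32 * n * Q))"
        unfolding w_def using n Q1 by (simp add: field_simps power2_eq_square)
      also have "\<dots> \<le> card (farey_shell Q \<inter> {z..z + w})"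
      proof -
        have "a / b \<notin> {z - 2 / Q..z + w + 2 / Q}" if "1 \<le> b" "b \<le> 32 * real n" for a b :: int
        proof
          assume "a / b \<in> {z - 2 / Q..z + w + 2 / Q}"
          then have "a / b \<in> {t..<t + 7 / Q}"
            using z half w \<open>1 / Q > 0\<close>
            unfolding w_def[symmetric] atLeastLessThan_iff atLeastAtMost_iff by linarith
          moreover have "b \<le> 32 * int n" using that by linarith
          ultimately show False using False that by blast
        qed
        then show ?thesis using farey_shell_dense[of Q "32 * real n" z "z + w"] n Q1 by simp
      qed
      finally show "card (farey_shell Q \<inter> {z..z + 1 / (4 * n * Q)}) \<ge> Q / (2 ^ 13 * real n ^ 3)"
        unfolding w_def .
    qed
  qed
qed

section \<open>Sampling trigonometric polynomials on short intervals\<close>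

lemma power_div_fact_le_exp:
  fixes x :: real
  assumes "x \<ge> 0"
  shows "x ^ n / fact n \<le> exp x"
proof -
  have s: "(\<lambda>k. x ^ k / fact k) sums exp x"
    using exp_converges[of x] by (simp add: scaleR_conv_of_real field_simps)
  have "(\<Sum>k\<in>{n}. x ^ k / fact k) \<le> (\<Sum>k. x ^ k / fact k)"
    using s assms by (intro sum_le_suminf) (auto simp: sums_iff)
  then show ?thesis using s by (simp add: sums_iff)
qed

lemma power_self_div_fact_le: "real n ^ n / fact n \<le> 3 ^ n"
proof -
  have "real n ^ n / fact n \<le> exp (real n)" by (rule power_div_fact_le_exp) simp
  also have "\<dots> = exp 1 ^ n" using exp_of_nat_mult[of n 1] by simp
  also have "\<dots> \<le> 3 ^ n" using exp_le by (intro power_mono) auto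
  finally show ?thesis .
qed

lemma norm_e [simp]: "norm (e x) = 1"
  unfolding e_def by (simp add: norm_exp_eq_Re)

lemma e_add: "e (x + y) = e x * e y"
  unfolding e_def by (simp add: exp_add algebra_simps)

lemma cnj_e: "cnj (e x) = e (- x)"
  unfolding e_def by (simp add: exp_cnj)

lemma has_vector_derivative_e:
  "((\<lambda>x. e (c * x)) has_vector_derivative (2 * of_real pi * \<i> * of_real c) * e (c * x)) (at x within A)"
  unfolding e_def
  by (auto intro!: derivative_eq_intros has_vector_derivative_real_field simp: algebra_simps)

text \<open>The derivative is again a sum of the form \<open>S N\<close>, so that Parseval's identity applies to all
derivatives at once.\<close>
lemma has_vector_derivative_S:
  "(S N \<phi> has_vector_derivative S N (\<lambda>k. (2 * of_real pi * \<i> * of_nat k) * \<phi> k) x) (at x within A)"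
proof -
  have "((\<lambda>x. \<Sum>k=1..N. \<phi> k * e (real k * x)) has_vector_derivative
      (\<Sum>k=1..N. \<phi> k * ((2 * of_real pi * \<i> * of_real (real k)) * e (real k * x)))) (at x within A)"
    by (intro has_vector_derivative_sum has_vector_derivative_mult_right has_vector_derivative_e)
  then show ?thesis unfolding S_def by (simp add: mult_ac)
qed

lemma continuous_on_S [continuous_intros]: "continuous_on A (S N \<phi>)"
  using has_vector_derivative_S has_vector_derivative_continuous
  by (force simp: continuous_on_eq_continuous_within)

lemma integral_e:
  fixes m :: int
  shows "((\<lambda>x. e (of_int m * x)) has_integral (if m = 0 then 1 else 0)) {0..1}"
proof (cases "m = 0")
  case True
  then show ?thesis using has_integral_const_real[of "1::complex" 0 1] by (simp add: e_def)
next
  case False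
  define c :: complex where "c = 2 * of_real pi * \<i> * of_real (of_int m)"
  have c: "c \<noteq> 0" using False unfolding c_def by simp
  have "((\<lambda>x. e (of_int m * x)) has_integral (1 / c * e (of_int m * 1) - 1 / c * e (of_int m * 0))) {0..1}"
  proof (rule fundamental_theorem_of_calculus)
    fix x :: real
    have "((\<lambda>x. 1 / c * e (of_int m * x)) has_vector_derivative 1 / c * (c * e (of_int m * x))) (at x within {0..1})"
      unfolding c_def by (intro has_vector_derivative_mult_right has_vector_derivative_e)
    then show "((\<lambda>x. 1 / c * e (of_int m * x)) has_vector_derivative e (of_int m * x)) (at x within {0..1})"
      using c by simp
  qed simp
  moreover have "e (of_int m) = 1"
  proof -
    have "e (of_int m) = exp (2 * of_int m * of_real pi * \<i>)" unfolding e_def by (simp add: mult_ac)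
    then show ?thesis using exp_integer_2pi[of "of_int m"] by simp
  qed
  ultimately show ?thesis using False by (simp add: e_def)
qed

lemma parseval_S:
  "((\<lambda>x. (norm (S N \<phi> x))\<^sup>2) has_integral (\<Sum>k=1..N. (norm (\<phi> k))\<^sup>2)) {0..1}"
proof -
  have eq: "complex_of_real ((norm (S N \<phi> x))\<^sup>2) =
      (\<Sum>j=1..N. \<Sum>k=1..N. \<phi> j * cnj (\<phi> k) * e (of_int (int j - int k) * x))" for x
  proof -
    have "complex_of_real ((norm (S N \<phi> x))\<^sup>2) = S N \<phi> x * cnj (S N \<phi> x)"
      by (rule complex_norm_square)
    also have "\<dots> = (\<Sum>j=1..N. \<Sum>k=1..N. (\<phi> j * e (real j * x)) * (cnj (\<phi> k) * e (- (real k * x))))"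
      unfolding S_def by (simp add: sum_product cnj_e)
    also have "\<dots> = (\<Sum>j=1..N. \<Sum>k=1..N. \<phi> j * cnj (\<phi> k) * e (of_int (int j - int k) * x))"
    proof (intro sum.cong refl)
      fix j k
      have "e (of_int (int j - int k) * x) = e (real j * x) * e (- (real k * x))"
        by (simp add: e_add[symmetric] algebra_simps)
      then show "(\<phi> j * e (real j * x)) * (cnj (\<phi> k) * e (- (real k * x)))
          = \<phi> j * cnj (\<phi> k) * e (of_int (int j - int k) * x)" by (simp add: mult_ac)
    qed
    finally show ?thesis .
  qed
  have "((\<lambda>x. \<Sum>j=1..N. \<Sum>k=1..N. \<phi> j * cnj (\<phi> k) * e (of_int (int j - int k) * x)) has_integral
      (\<Sum>j=1..N. \<Sum>k=1..N. \<phi> j * cnj (\<phi> k) * (if int j - int k = 0 then 1 else 0))) {0..1}"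
    by (intro has_integral_sum has_integral_mult_right integral_e) auto
  also have "(\<Sum>j=1..N. \<Sum>k=1..N. \<phi> j * cnj (\<phi> k) * (if int j - int k = 0 then 1 else 0)) =
      (\<Sum>j=1..N. \<Sum>k=1..N. if k = j then \<phi> j * cnj (\<phi> j) else 0)"
    by (intro sum.cong refl) auto
  also have "\<dots> = of_real (\<Sum>k=1..N. (norm (\<phi> k))\<^sup>2)"
    unfolding of_real_sum complex_norm_square by (simp add: sum.delta)
  finally have "((\<lambda>x. complex_of_real ((norm (S N \<phi> x))\<^sup>2)) has_integral
      of_real (\<Sum>k=1..N. (norm (\<phi> k))\<^sup>2)) {0..1}" unfolding eq .
  from has_integral_Re[OF this] show ?thesis by simp
qed

text \<open>Expand the integral of \<open>(g - M)\<^sup>2 \<ge> 0\<close>, where \<open>M\<close> is the mean value of \<open>g\<close>.\<close>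
lemma Cauchy_Schwarz_integral:
  fixes g :: "real \<Rightarrow> real"
  assumes "a \<le> b" and g: "continuous_on {a..b} g"
  shows "(integral {a..b} g)\<^sup>2 \<le> (b - a) * integral {a..b} (\<lambda>t. (g t)\<^sup>2)"
proof (cases "a = b")
  case False
  then have ab: "b - a > 0" using assms by simp
  define I where "I = integral {a..b} g"
  define K where "K = integral {a..b} (\<lambda>t. (g t)\<^sup>2)"
  define M where "M = I / (b - a)"
  have 1: "(g has_integral I) {a..b}"
    unfolding I_def by (intro integrable_integral integrable_continuous_real g)
  have 2: "((\<lambda>t. (g t)\<^sup>2) has_integral K) {a..b}"
    unfolding K_def by (intro integrable_integral integrable_continuous_real continuous_intros g)
  have "((\<lambda>t. (g t)\<^sup>2 - 2 * M * g t + M\<^sup>2) has_integral (K - 2 * M * I + (b - a) *\<^sub>R M\<^sup>2)) {a..b}"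
    using 1 2 \<open>a \<le> b\<close> has_integral_const_real[of "M\<^sup>2" a b]
    by (intro has_integral_add has_integral_diff has_integral_mult_right) auto
  then have "K - 2 * M * I + (b - a) *\<^sub>R M\<^sup>2 \<ge> 0"
  proof (rule has_integral_nonneg)
    fix t
    have "0 \<le> (g t - M)\<^sup>2" by simp
    then show "0 \<le> (g t)\<^sup>2 - 2 * M * g t + M\<^sup>2" unfolding power2_diff by (simp add: mult_ac)
  qed
  then have "(b - a) * (K - 2 * M * I + (b - a) * M\<^sup>2) \<ge> 0" using ab by (intro mult_nonneg_nonneg) auto
  moreover have "(b - a) * M = I" unfolding M_def using ab by simp
  moreover have "(b - a) * (K - 2 * M * I + (b - a) * M\<^sup>2)
      = (b - a) * K - 2 * ((b - a) * M) * I + ((b - a) * M)\<^sup>2"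
    by (simp add: algebra_simps power2_eq_square)
  ultimately show ?thesis unfolding I_def[symmetric] K_def[symmetric]
    by (simp add: power2_eq_square)
qed simp

text \<open>The mean square of the derivative, rather than its maximum, appears on the right because mean squares
over adjacent intervals add up to a quantity that Parseval's identity evaluates.\<close>
lemma Taylor_remainder_L2:
  fixes Df :: "nat \<Rightarrow> real \<Rightarrow> complex"
  assumes "p > 0"
    and Df: "\<And>m t. (Df m has_vector_derivative Df (Suc m) t) (at t within {a..b})"
    and x: "x \<in> {a..b}"
  shows "(norm (Df 0 x - (\<Sum>i<p. ((x - a) ^ i / fact i) *\<^sub>R Df i a)))\<^sup>2
     \<le> (b - a) ^ (2 * p - 1) / (fact (p - 1))\<^sup>2 * integral {a..b} (\<lambda>t. (norm (Df p t))\<^sup>2)"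
proof -
  define R where "R = Df 0 x - (\<Sum>i<p. ((x - a) ^ i / fact i) *\<^sub>R Df i a)"
  define K where "K = (b - a) ^ (p - 1) / fact (p - 1)"
  have K0: "K \<ge> 0" using x unfolding K_def by simp
  have "((\<lambda>t. ((x - t) ^ (p - 1) / fact (p - 1)) *\<^sub>R Df p t) has_integral R) {a..x}"
    unfolding R_def
  proof (rule Taylor_has_integral)
    fix m t assume "m < p"
    show "(Df m has_vector_derivative Df (Suc m) t) (at t within {a..x})"
      using Df x by (rule_tac has_vector_derivative_within_subset) auto
  qed (use assms in auto)
  then have R: "R = integral {a..x} (\<lambda>t. ((x - t) ^ (p - 1) / fact (p - 1)) *\<^sub>R Df p t)"
    and int: "(\<lambda>t. ((x - t) ^ (p - 1) / fact (p - 1)) *\<^sub>R Df p t) integrable_on {a..x}"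
    by (auto simp: has_integral_integrable_integral)
  have cont: "continuous_on {a..b} (\<lambda>t. norm (Df p t))"
    using Df has_vector_derivative_continuous
    by (intro continuous_on_norm) (force simp: continuous_on_eq_continuous_within)
  have contx: "continuous_on {a..x} (\<lambda>t. norm (Df p t))"
    using cont by (rule continuous_on_subset) (use x in auto)
  have "norm R \<le> integral {a..x} (\<lambda>t. K * norm (Df p t))"
    unfolding R
  proof (rule integral_norm_bound_integral[OF int])
    show "(\<lambda>t. K * norm (Df p t)) integrable_on {a..x}"
      by (intro integrable_continuous_real continuous_on_mult_left contx)
    fix t assume t: "t \<in> {a..x}"
    have "(x - t) ^ (p - 1) \<le> (b - a) ^ (p - 1)" using t x by (intro power_mono) auto
    then have "(x - t) ^ (p - 1) / fact (p - 1) \<le> K" unfolding K_def by (intro divide_right_mono) auto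
    moreover have "(x - t) ^ (p - 1) / fact (p - 1) \<ge> 0" using t by simp
    ultimately show "norm (((x - t) ^ (p - 1) / fact (p - 1)) *\<^sub>R Df p t) \<le> K * norm (Df p t)"
      unfolding norm_scaleR by (intro mult_right_mono) auto
  qed
  also have "\<dots> = K * integral {a..x} (\<lambda>t. norm (Df p t))" by simp
  also have "\<dots> \<le> K * integral {a..b} (\<lambda>t. norm (Df p t))"
    using K0 x cont contx
    by (intro mult_left_mono integral_subset_le integrable_continuous_real) auto
  finally have "(norm R)\<^sup>2 \<le> (K * integral {a..b} (\<lambda>t. norm (Df p t)))\<^sup>2"
    by (intro power_mono) auto
  also have "\<dots> = K\<^sup>2 * (integral {a..b} (\<lambda>t. norm (Df p t)))\<^sup>2" by (simp add: power_mult_distrib)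
  also have "\<dots> \<le> K\<^sup>2 * ((b - a) * integral {a..b} (\<lambda>t. (norm (Df p t))\<^sup>2))"
    using x by (intro mult_left_mono Cauchy_Schwarz_integral cont) auto
  also have "K\<^sup>2 * (b - a) = (b - a) ^ (2 * p - 1) / (fact (p - 1))\<^sup>2"
  proof -
    have "2 * p - 1 = Suc ((p - 1) * 2)" using \<open>p > 0\<close> by simp
    then show ?thesis unfolding K_def by (simp add: power_divide power_mult)
  qed
  then have "K\<^sup>2 * ((b - a) * integral {a..b} (\<lambda>t. (norm (Df p t))\<^sup>2)) =
      (b - a) ^ (2 * p - 1) / (fact (p - 1))\<^sup>2 * integral {a..b} (\<lambda>t. (norm (Df p t))\<^sup>2)"
    by (metis mult.assoc)
  finally show ?thesis unfolding R_def .
qed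

text \<open>Both sides are polynomials in \<open>z\<close> of degree below \<open>n\<close> that agree at the \<open>n\<close> nodes.\<close>
lemma lagrange_interpolation:
  fixes P :: "'a::field poly" and x :: "nat \<Rightarrow> 'a"
  assumes inj: "inj_on x {..<n}" and deg: "degree P < n"
  shows "poly P z = (\<Sum>i<n. poly P (x i) * (\<Prod>j\<in>{..<n}-{i}. (z - x j) / (x i - x j)))"
proof -
  define L where "L i = (\<Prod>j\<in>{..<n}-{i}. smult (1 / (x i - x j)) [:- x j, 1:])" for i
  define R where "R = (\<Sum>i<n. smult (poly P (x i)) (L i))"
  have L: "poly (L i) z = (\<Prod>j\<in>{..<n}-{i}. (z - x j) / (x i - x j))" for i z
    unfolding L_def poly_prod by (intro prod.cong) (auto simp: diff_divide_distrib)
  have "P = R"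
  proof (rule poly_eqI_degree[where A = "x ` {..<n}"])
    show "degree P < card (x ` {..<n})" using inj deg by (simp add: card_image)
    have "degree (L i) \<le> n - 1" if "i < n" for i
    proof -
      have "degree (L i) \<le> (\<Sum>j\<in>{..<n}-{i}. degree (smult (1 / (x i - x j)) [:- x j, 1:]))"
        unfolding L_def by (intro degree_prod_sum_le[unfolded o_def]) auto
      also have "\<dots> \<le> (\<Sum>j\<in>{..<n}-{i}. 1)"
        by (intro sum_mono order_trans[OF degree_smult_le]) auto
      also have "\<dots> = n - 1" using that by simp
      finally show ?thesis .
    qed
    then have "degree R \<le> n - 1"
      unfolding R_def by (intro degree_sum_le) (auto intro: order_trans[OF degree_smult_le])
    then show "degree R < card (x ` {..<n})" using inj deg by (simp add: card_image)
    fix z assume "z \<in> x ` {..<n}"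
    then obtain k where k: "k < n" "z = x k" by auto
    have "poly (L i) (x k) = (if i = k then 1 else 0)" if "i < n" for i
    proof (cases "i = k")
      case True
      have "x k - x j \<noteq> 0" if "j \<in> {..<n} - {k}" for j
        using inj that k by (auto simp: inj_on_def)
      then show ?thesis using True unfolding L by (auto intro!: prod.neutral)
    next
      case False
      then show ?thesis using k unfolding L by (auto intro!: prod_zero)
    qed
    then have "poly R (x k) = (\<Sum>i<n. if i = k then poly P (x k) else 0)"
      unfolding R_def poly_sum by (intro sum.cong) auto
    then show "poly P z = poly R z" using k by simp
  qed
  then have "poly P z = poly R z" by simp
  then show ?thesis unfolding R_def by (simp add: poly_sum L)
qed

lemma prod_dist_fact:
  fixes i n :: nat
  assumes "i < n"
  shows "(\<Prod>j\<in>{..<n}-{i}. \<bar>real i - real j\<bar>) = fact i * fact (n - 1 - i)"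
proof -
  have split: "{..<n} - {i} = {..<i} \<union> {Suc i..<n}" using assms by auto
  have "(\<Prod>j<i. \<bar>real i - real j\<bar>) = (\<Prod>j<i. real (i - j))"
    by (intro prod.cong) auto
  also have "\<dots> = (\<Prod>j=1..i. real j)"
    by (rule prod.reindex_bij_witness[of _ "\<lambda>j. i - j" "\<lambda>j. i - j"]) auto
  finally have 1: "(\<Prod>j<i. \<bar>real i - real j\<bar>) = fact i" by (simp add: fact_prod)
  have "(\<Prod>j=Suc i..<n. \<bar>real i - real j\<bar>) = (\<Prod>j=Suc i..<n. real (j - i))"
    by (intro prod.cong) auto
  also have "\<dots> = (\<Prod>j=1..n - 1 - i. real j)"
    by (rule prod.reindex_bij_witness[of _ "\<lambda>j. j + i" "\<lambda>j. j - i"]) auto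
  finally have 2: "(\<Prod>j=Suc i..<n. \<bar>real i - real j\<bar>) = fact (n - 1 - i)" by (simp add: fact_prod)
  have "(\<Prod>j\<in>{..<n}-{i}. \<bar>real i - real j\<bar>)
      = (\<Prod>j<i. \<bar>real i - real j\<bar>) * (\<Prod>j=Suc i..<n. \<bar>real i - real j\<bar>)"
    unfolding split by (rule prod.union_disjoint) auto
  then show ?thesis unfolding 1 2 .
qed

text \<open>The distances from the \<open>i\<close>-th node multiply to at least \<open>w ^ (n - 1) i! (n - 1 - i)!\<close>, and the
factorials compare with \<open>(n - 1)!\<close> through a binomial coefficient, at most \<open>2 ^ (n - 1)\<close>.\<close>
lemma lagrange_basis_bound:
  fixes x :: "nat \<Rightarrow> real"
  assumes i: "i < n" and w: "w > 0" and h: "\<And>j. j < n \<Longrightarrow> \<bar>z - x j\<bar> \<le> h"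
    and sep: "\<And>i j. i < n \<Longrightarrow> j < n \<Longrightarrow> \<bar>x i - x j\<bar> \<ge> \<bar>real i - real j\<bar> * w"
  shows "\<bar>\<Prod>j\<in>{..<n}-{i}. (z - x j) / (x i - x j)\<bar> \<le> (2 * h / w) ^ (n - 1) / fact (n - 1)"
proof -
  have h0: "h \<ge> 0" using h[OF i] by linarith
  have "\<bar>\<Prod>j\<in>{..<n}-{i}. (z - x j) / (x i - x j)\<bar> = (\<Prod>j\<in>{..<n}-{i}. \<bar>z - x j\<bar> / \<bar>x i - x j\<bar>)"
    by (simp add: abs_prod)
  also have "\<dots> \<le> (\<Prod>j\<in>{..<n}-{i}. (h / w) / \<bar>real i - real j\<bar>)"
  proof (rule prod_mono)
    fix j assume j: "j \<in> {..<n} - {i}"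
    have "\<bar>real i - real j\<bar> * w > 0" using j w by simp
    then have "\<bar>z - x j\<bar> / \<bar>x i - x j\<bar> \<le> h / (\<bar>real i - real j\<bar> * w)"
      using j h[of j] sep[of i j] i by (intro frac_le) auto
    then show "0 \<le> \<bar>z - x j\<bar> / \<bar>x i - x j\<bar> \<and> \<bar>z - x j\<bar> / \<bar>x i - x j\<bar> \<le> h / w / \<bar>real i - real j\<bar>"
      by (simp add: mult.commute)
  qed
  also have "\<dots> = (h / w) ^ (n - 1) / (fact i * fact (n - 1 - i))"
    unfolding prod_dividef prod_dist_fact[OF i] using i by (simp add: power_divide)
  also have "\<dots> = (h / w) ^ (n - 1) * real ((n - 1) choose i) / fact (n - 1)"
    using i by (subst binomial_fact) (auto simp: field_simps)
  also have "\<dots> \<le> (h / w) ^ (n - 1) * 2 ^ (n - 1) / fact (n - 1)"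
  proof -
    have "real ((n - 1) choose i) \<le> 2 ^ (n - 1)"
      using binomial_le_pow2[of "n - 1" i] by (metis of_nat_le_iff of_nat_numeral of_nat_power)
    then show ?thesis using h0 w by (intro divide_right_mono mult_left_mono) auto
  qed
  also have "\<dots> = (2 * h / w) ^ (n - 1) / fact (n - 1)"
    by (simp add: power_mult_distrib power_divide)
  finally show ?thesis .
qed

lemma power2_add_le:
  fixes x y :: real
  shows "(x + y)\<^sup>2 \<le> 2 * x\<^sup>2 + 2 * y\<^sup>2"
  using sum_squares_bound[of x y] by (simp add: power2_sum)

text \<open>A function that is nearly a polynomial of degree below \<open>n\<close> is nearly equal to its Lagrange
interpolant: interpolation reproduces the polynomial exactly and enlarges the error by the Lebesgue
constant \<open>n \<Lambda>\<close>. The form with squares is the one that can be integrated.\<close>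
lemma interpolation_bound:
  fixes f :: "real \<Rightarrow> complex" and P :: "complex poly" and x :: "nat \<Rightarrow> real"
  assumes n: "n > 0" and w: "w > 0" and deg: "degree P < n"
    and approx: "\<And>y. y \<in> {a..b} \<Longrightarrow> (norm (f y - poly P (of_real y)))\<^sup>2 \<le> \<rho>"
    and nodes: "\<And>j. j < n \<Longrightarrow> x j \<in> {a..b}" and z: "z \<in> {a..b}"
    and sep: "\<And>i j. i < n \<Longrightarrow> j < n \<Longrightarrow> \<bar>x i - x j\<bar> \<ge> \<bar>real i - real j\<bar> * w"
    and \<Lambda>: "(2 * (b - a) / w) ^ (n - 1) / fact (n - 1) \<le> \<Lambda>"
  shows "(norm (f z))\<^sup>2 \<le> 2 * \<Lambda>\<^sup>2 * n * (\<Sum>i<n. (norm (f (x i)))\<^sup>2) + 2 * (n * \<Lambda> + 1)\<^sup>2 * \<rho>"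
proof -
  define l where "l i = (\<Prod>j\<in>{..<n}-{i}. (z - x j) / (x i - x j))" for i
  have l: "\<bar>l i\<bar> \<le> \<Lambda>" if "i < n" for i
  proof -
    have "\<bar>l i\<bar> \<le> (2 * (b - a) / w) ^ (n - 1) / fact (n - 1)"
      unfolding l_def
    proof (rule lagrange_basis_bound[OF that w _ sep])
      fix j assume "j < n"
      then show "\<bar>z - x j\<bar> \<le> b - a" using nodes[of j] z by auto
    qed auto
    then show ?thesis using \<Lambda> by linarith
  qed
  have \<Lambda>0: "\<Lambda> \<ge> 0" using l[OF n] by linarith
  have \<rho>: "\<rho> \<ge> 0" using approx[OF z] by (meson order_trans zero_le_power2)
  define \<epsilon> where "\<epsilon> = sqrt \<rho>"
  have \<epsilon>: "norm (f y - poly P (of_real y)) \<le> \<epsilon>" if "y \<in> {a..b}" for y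
    using approx[OF that] unfolding \<epsilon>_def by (rule real_le_rsqrt)
  have inj: "inj_on (\<lambda>i. complex_of_real (x i)) {..<n}"
  proof (rule inj_onI)
    fix i j assume *: "i \<in> {..<n}" "j \<in> {..<n}" "complex_of_real (x i) = complex_of_real (x j)"
    then have "\<bar>real i - real j\<bar> * w \<le> 0" using sep[of i j] by simp
    then show "i = j" using w by (auto simp: mult_le_0_iff)
  qed
  have "poly P (of_real z) = (\<Sum>i<n. poly P (of_real (x i)) * of_real (l i))"
    using lagrange_interpolation[OF inj deg, of "of_real z"] unfolding l_def by simp
  then have "f z = (f z - poly P (of_real z)) - (\<Sum>i<n. (f (x i) - poly P (of_real (x i))) * of_real (l i))
      + (\<Sum>i<n. f (x i) * of_real (l i))"
    by (simp add: algebra_simps sum_subtractf)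
  also have "norm \<dots> \<le> norm (f z - poly P (of_real z))
      + norm (\<Sum>i<n. (f (x i) - poly P (of_real (x i))) * of_real (l i))
      + norm (\<Sum>i<n. f (x i) * of_real (l i))"
    by (rule order_trans[OF norm_triangle_ineq add_right_mono[OF norm_triangle_ineq4]])
  also have "\<dots> \<le> \<epsilon> + (\<Sum>i<n. \<epsilon> * \<Lambda>) + (\<Sum>i<n. norm (f (x i)) * \<Lambda>)"
  proof (intro add_mono sum_norm_le)
    show "norm (f z - poly P (of_real z)) \<le> \<epsilon>" using \<epsilon>[OF z] .
    fix i assume i: "i \<in> {..<n}"
    show "norm ((f (x i) - poly P (of_real (x i))) * of_real (l i)) \<le> \<epsilon> * \<Lambda>"
      unfolding norm_mult norm_of_real using \<epsilon>[of "x i"] nodes l i \<epsilon>_def \<rho> by (intro mult_mono) auto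
    show "norm (f (x i) * of_real (l i)) \<le> norm (f (x i)) * \<Lambda>"
      unfolding norm_mult norm_of_real using l i by (intro mult_left_mono) auto
  qed
  also have "\<dots> = (n * \<Lambda> + 1) * \<epsilon> + \<Lambda> * (\<Sum>i<n. norm (f (x i)))"
    by (simp add: sum_distrib_left algebra_simps)
  finally have "(norm (f z))\<^sup>2 \<le> ((n * \<Lambda> + 1) * \<epsilon> + \<Lambda> * (\<Sum>i<n. norm (f (x i))))\<^sup>2"
    by (intro power_mono) auto
  also have "\<dots> \<le> 2 * ((n * \<Lambda> + 1) * \<epsilon>)\<^sup>2 + 2 * (\<Lambda> * (\<Sum>i<n. norm (f (x i))))\<^sup>2"
    by (rule power2_add_le)
  also have "\<dots> = 2 * (n * \<Lambda> + 1)\<^sup>2 * \<rho> + 2 * \<Lambda>\<^sup>2 * (\<Sum>i<n. norm (f (x i)))\<^sup>2"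
    using \<rho> unfolding \<epsilon>_def by (simp add: power_mult_distrib)
  also have "\<dots> \<le> 2 * (n * \<Lambda> + 1)\<^sup>2 * \<rho> + 2 * \<Lambda>\<^sup>2 * (n * (\<Sum>i<n. (norm (f (x i)))\<^sup>2))"
  proof -
    have "(\<Sum>i<n. norm (f (x i)))\<^sup>2 \<le> n * (\<Sum>i<n. (norm (f (x i)))\<^sup>2)"
      using Cauchy_Schwarz_ineq_sum[of "\<lambda>i. norm (f (x i))" "\<lambda>_. 1" "{..<n}"] by (simp add: mult.commute)
    then show ?thesis by (intro add_left_mono mult_left_mono) auto
  qed
  finally show ?thesis by (simp add: algebra_simps)
qed

lemma iterated_derivative_S:
  fixes \<phi> :: "nat \<Rightarrow> complex"
  shows "(S N (\<lambda>k. (2 * of_real pi * \<i> * of_nat k) ^ m * \<phi> k) has_vector_derivative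
     S N (\<lambda>k. (2 * of_real pi * \<i> * of_nat k) ^ Suc m * \<phi> k) t) (at t within A)"
  using has_vector_derivative_S[of N "\<lambda>k. (2 * of_real pi * \<i> * of_nat k) ^ m * \<phi> k" t A]
  by (simp add: mult.assoc)

lemma bernstein_L2:
  "(\<Sum>k=1..N. (norm ((2 * of_real pi * \<i> * of_nat k) ^ m * \<phi> k))\<^sup>2)
     \<le> (2 * pi * N) ^ (2 * m) * (\<Sum>k=1..N. (norm (\<phi> k))\<^sup>2)"
  unfolding sum_distrib_left
proof (rule sum_mono)
  fix k assume k: "k \<in> {1..N}"
  have "(norm ((2 * of_real pi * \<i> * of_nat k) ^ m * \<phi> k))\<^sup>2 = (2 * pi * k) ^ (2 * m) * (norm (\<phi> k))\<^sup>2"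
    by (simp add: norm_mult norm_power power_mult_distrib power_mult mult.commute flip: power_mult)
  also have "\<dots> \<le> (2 * pi * N) ^ (2 * m) * (norm (\<phi> k))\<^sup>2"
    using k by (intro mult_right_mono power_mono) auto
  finally show "(norm ((2 * of_real pi * \<i> * of_nat k) ^ m * \<phi> k))\<^sup>2
      \<le> (2 * pi * N) ^ (2 * m) * (norm (\<phi> k))\<^sup>2" .
qed

lemma integral_split_equal_parts:
  fixes g :: "real \<Rightarrow> real"
  assumes m: "m > 0" and g: "continuous_on UNIV g"
  shows "integral {0..1} g = (\<Sum>j<m. integral {real j / m..real (Suc j) / m} g)"
proof -
  have int: "g integrable_on {a..b}" for a b
    by (intro integrable_continuous_real continuous_on_subset[OF g]) auto
  have "integral {0..real k / m} g = (\<Sum>j<k. integral {real j / m..real (Suc j) / m} g)" for k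
  proof (induction k)
    case (Suc k)
    have "integral {0..real (Suc k) / m} g
        = integral {0..real k / m} g + integral {real k / m..real (Suc k) / m} g"
      using m by (intro Henstock_Kurzweil_Integration.integral_combine[symmetric] int)
        (auto simp: divide_right_mono)
    then show ?case using Suc by simp
  qed simp
  from this[of m] show ?thesis using m by simp
qed

lemma exists_below_average:
  fixes g :: "'a \<Rightarrow> real"
  assumes "finite A" "real (card A) \<ge> T" "T > 0" "\<And>x. g x \<ge> 0"
  shows "\<exists>x\<in>A. T * g x \<le> sum g A"
proof -
  have "A \<noteq> {}" using assms by auto
  then obtain x where x: "x \<in> A" "\<And>y. y \<in> A \<Longrightarrow> g x \<le> g y"
    using finite_has_minimal2 assms(1) ex_min_if_finite[of "g ` A"]
    by (metis arg_min_if_finite(1) arg_min_least)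
  have "T * g x \<le> card A * g x" using assms by (intro mult_right_mono) auto
  also have "\<dots> \<le> sum g A" using x by (intro sum_bounded_below) auto
  finally show ?thesis using x by blast
qed

text \<open>The pieces are every other interval of a subdivision into intervals of length \<open>w\<close>, so that points from
the \<open>i\<close>-th and the \<open>j\<close>-th piece are at least \<open>(2 |i - j| - 1) w\<close> apart. In each piece the node is a point
where \<open>g\<close> is at most its average over the points of \<open>Y\<close> in that piece.\<close>
lemma spread_nodes:
  fixes g :: "real \<Rightarrow> real" and w T y :: real and n :: nat
  assumes w: "w > 0" and T: "T > 0" and g: "\<And>x. g x \<ge> 0"
    and Y: "finite Y" and piece: "\<And>i::nat. i < n \<Longrightarrow> card (Y \<inter> {y + 2 * real i * w..y + 2 * real i * w + w}) \<ge> T"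
    and sub: "\<And>i::nat. i < n \<Longrightarrow> {y + 2 * real i * w..y + 2 * real i * w + w} \<subseteq> J"
  obtains x :: "nat \<Rightarrow> real" where "\<And>i. i < n \<Longrightarrow> x i \<in> J"
    "\<And>i j. i < n \<Longrightarrow> j < n \<Longrightarrow> \<bar>x i - x j\<bar> \<ge> \<bar>real i - real j\<bar> * w"
    "T * (\<Sum>i<n. g (x i)) \<le> sum g (Y \<inter> J)"
proof -
  define I where "I i = {y + 2 * real i * w..y + 2 * real i * w + w}" for i :: nat
  have "\<exists>x. x \<in> Y \<inter> I i \<and> T * g x \<le> sum g (Y \<inter> I i)" if "i < n" for i
    using exists_below_average[of "Y \<inter> I i" T g] Y piece[OF that] T g unfolding I_def by blast
  then obtain x where x: "\<And>i. i < n \<Longrightarrow> x i \<in> Y \<inter> I i \<and> T * g (x i) \<le> sum g (Y \<inter> I i)"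
    by metis
  have far: "x j - x i \<ge> (real j - real i) * w" if "i < j" "j < n" for i j
  proof -
    have "x j \<ge> y + 2 * real j * w" "x i \<le> y + 2 * real i * w + w"
      using x[of i] x[of j] that unfolding I_def by auto
    then have "x j - x i \<ge> (2 * (real j - real i) - 1) * w" by (simp add: algebra_simps)
    moreover have "(2 * (real j - real i) - 1) * w \<ge> (real j - real i) * w"
      using that w by (intro mult_right_mono) auto
    ultimately show ?thesis by linarith
  qed
  show ?thesis
  proof (rule that[of x])
    show "x i \<in> J" if "i < n" for i using x[OF that] sub[OF that] unfolding I_def by blast
    show "\<bar>x i - x j\<bar> \<ge> \<bar>real i - real j\<bar> * w" if "i < n" "j < n" for i j
      using far[of i j] far[of j i] that by (cases i j rule: linorder_cases) auto
    have disj: "I i \<inter> I j = {}" if "i < j" for i j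
    proof -
      have "real j \<ge> real i + 1" using that by linarith
      then have "2 * real j * w \<ge> 2 * (real i + 1) * w" using w by (intro mult_right_mono) auto
      then have "2 * real j * w \<ge> 2 * real i * w + 2 * w" by (simp add: algebra_simps)
      then show ?thesis using w unfolding I_def by auto
    qed
    have "T * (\<Sum>i<n. g (x i)) \<le> (\<Sum>i<n. sum g (Y \<inter> I i))"
      unfolding sum_distrib_left using x by (intro sum_mono) auto
    also have "\<dots> = sum g (\<Union>i<n. Y \<inter> I i)"
    proof (rule sum.UNION_disjoint[symmetric])
      show "\<forall>i\<in>{..<n}. \<forall>j\<in>{..<n}. i \<noteq> j \<longrightarrow> Y \<inter> I i \<inter> (Y \<inter> I j) = {}"
      proof (intro ballI impI)
        fix i j :: nat assume "i \<noteq> j"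
        then show "Y \<inter> I i \<inter> (Y \<inter> I j) = {}"
          using disj[of i j] disj[of j i] by (cases i j rule: linorder_cases) auto
      qed
    qed (use Y in auto)
    also have "\<dots> \<le> sum g (Y \<inter> J)"
      using sub Y g unfolding I_def by (intro sum_mono2) blast+
    finally show "T * (\<Sum>i<n. g (x i)) \<le> sum g (Y \<inter> J)" .
  qed
qed

text \<open>Interpolate the Taylor polynomial of degree below \<open>n\<close> at the left end \<open>a\<close>, then integrate the resulting
pointwise bound. The half-open interval in the sum keeps the sampling points of adjacent intervals
disjoint.\<close>
lemma sampling_on_interval:
  fixes \<phi> :: "nat \<Rightarrow> complex" and a h w T \<Lambda> y :: real
  and n N :: nat and Y :: "real set"
  defines "D \<equiv> S N (\<lambda>k. (2 * of_real pi * \<i> * of_nat k) ^ n * \<phi> k)"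
  assumes n: "n > 0" and w: "w > 0" and T: "T > 0" and h: "h \<ge> 0" and Y: "finite Y"
    and J: "a \<le> y" "y + 2 * real n * w < a + h"
    and piece: "\<And>i::nat. i < n \<Longrightarrow> card (Y \<inter> {y + 2 * real i * w..y + 2 * real i * w + w}) \<ge> T"
    and \<Lambda>: "(2 * h / w) ^ (n - 1) / fact (n - 1) \<le> \<Lambda>"
  shows "integral {a..a + h} (\<lambda>x. (norm (S N \<phi> x))\<^sup>2) \<le>
     2 * \<Lambda>\<^sup>2 * n * h / T * (\<Sum>x\<in>Y \<inter> {a..<a + h}. (norm (S N \<phi> x))\<^sup>2)
     + 2 * ((n * \<Lambda> + 1) * (h ^ n / fact (n - 1)))\<^sup>2 * integral {a..a + h} (\<lambda>x. (norm (D x))\<^sup>2)"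
proof -
  define f where "f = S N \<phi>"
  define Df where "Df m = S N (\<lambda>k. (2 * of_real pi * \<i> * of_nat k) ^ m * \<phi> k)" for m
  have Df: "(Df m has_vector_derivative Df (Suc m) t) (at t within A)" for m t A
    unfolding Df_def by (rule iterated_derivative_S)
  have Df0: "Df 0 = f" unfolding Df_def f_def by simp
  have Dfn: "Df n = D" unfolding Df_def D_def ..
  define P :: "complex poly" where
    "P = (\<Sum>i<n. smult (Df i a / fact i) ([:- of_real a, 1:] ^ i))"
  define \<rho> where "\<rho> = h ^ (2 * n - 1) / (fact (n - 1))\<^sup>2 * integral {a..a + h} (\<lambda>t. (norm (D t))\<^sup>2)"
  define F where "F = (\<Sum>x\<in>Y \<inter> {a..<a + h}. (norm (f x))\<^sup>2)"
  have "degree P \<le> n - 1"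
    unfolding P_def
  proof (intro degree_sum_le)
    fix i assume "i \<in> {..<n}"
    have "degree ([:- complex_of_real a, 1:] ^ i) \<le> degree [:- complex_of_real a, 1:] * i"
      by (rule degree_power_le)
    also have "\<dots> \<le> n - 1" using \<open>i \<in> {..<n}\<close> by simp
    finally show "degree (smult (Df i a / fact i) ([:- of_real a, 1:] ^ i)) \<le> n - 1"
      by (rule order_trans[OF degree_smult_le])
  qed simp
  then have deg: "degree P < n" using n by simp
  have P: "poly P (of_real x) = (\<Sum>i<n. ((x - a) ^ i / fact i) *\<^sub>R Df i a)" for x
    unfolding P_def poly_sum
    by (intro sum.cong) (simp_all add: scaleR_conv_of_real of_real_diff)
  have approx: "(norm (f x - poly P (of_real x)))\<^sup>2 \<le> \<rho>" if "x \<in> {a..a + h}" for x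
    using Taylor_remainder_L2[of n Df a "a + h" x] n Df that unfolding P \<rho>_def Df0 Dfn by simp
  have "{y + 2 * real i * w..y + 2 * real i * w + w} \<subseteq> {a..<a + h}" if "i < n" for i :: nat
  proof -
    have "2 * real i * w + w \<le> 2 * real n * w"
    proof -
      have "(2 * real i + 1) * w \<le> 2 * real n * w" using that w by (intro mult_right_mono) auto
      then show ?thesis by (simp add: algebra_simps)
    qed
    moreover have "2 * real i * w \<ge> 0" using w by simp
    ultimately show ?thesis
      using J by (intro subsetI, unfold atLeastAtMost_iff atLeastLessThan_iff) (intro conjI; linarith)
  qed
  then obtain x where x: "\<And>i. i < n \<Longrightarrow> x i \<in> {a..<a + h}"
    "\<And>i j. i < n \<Longrightarrow> j < n \<Longrightarrow> \<bar>x i - x j\<bar> \<ge> \<bar>real i - real j\<bar> * w"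
    "T * (\<Sum>i<n. (norm (f (x i)))\<^sup>2) \<le> F"
    using spread_nodes[of w T "\<lambda>x. (norm (f x))\<^sup>2" Y n y "{a..<a + h}"] w T Y piece
    unfolding F_def by auto
  have F: "(\<Sum>i<n. (norm (f (x i)))\<^sup>2) \<le> F / T"
    using x(3) T by (simp add: field_simps)
  define B where "B = 2 * \<Lambda>\<^sup>2 * n * (F / T) + 2 * (n * \<Lambda> + 1)\<^sup>2 * \<rho>"
  have bound: "(norm (f z))\<^sup>2 \<le> B" if z: "z \<in> {a..a + h}" for z
  proof -
    have "(norm (f z))\<^sup>2 \<le> 2 * \<Lambda>\<^sup>2 * n * (\<Sum>i<n. (norm (f (x i)))\<^sup>2) + 2 * (n * \<Lambda> + 1)\<^sup>2 * \<rho>"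
      using x(1) by (intro interpolation_bound[OF n w deg approx _ z x(2)]) (use \<Lambda> in \<open>auto simp: less_imp_le\<close>)
    also have "\<dots> \<le> B" unfolding B_def using F by (intro add_right_mono mult_left_mono) auto
    finally show ?thesis .
  qed
  have "integral {a..a + h} (\<lambda>x. (norm (f x))\<^sup>2) \<le> integral {a..a + h} (\<lambda>_. B)"
    using bound unfolding f_def
    by (intro integral_le integrable_continuous_real continuous_intros) auto
  also have "\<dots> = h * B" using h by simp
  also have "\<dots> = 2 * \<Lambda>\<^sup>2 * n * h / T * F + 2 * (n * \<Lambda> + 1)\<^sup>2 * (h * \<rho>)"
    unfolding B_def by (simp add: algebra_simps)
  also have "h * \<rho> = (h ^ n / fact (n - 1))\<^sup>2 * integral {a..a + h} (\<lambda>x. (norm (D x))\<^sup>2)"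
  proof -
    have "h * h ^ (2 * n - 1) = (h ^ n)\<^sup>2"
      using n by (simp flip: power_Suc power_mult add: mult.commute)
    then show ?thesis unfolding \<rho>_def by (simp add: power_divide)
  qed
  finally show ?thesis unfolding F_def f_def by (simp only: power_mult_distrib mult.assoc)
qed

text \<open>Summing \<open>sampling_on_interval\<close> over the \<open>m\<close> intervals of length \<open>1/m\<close> turns the local error terms
into the mean square of the \<open>n\<close>-th derivative over a full period, which Parseval's identity bounds by
\<open>(2 pi N) ^ (2 n)\<close> times the mass of \<open>\<phi>\<close>. The inequality is useful once the second term on the right is
at most half of the left-hand side.\<close>
lemma sampling_inequality:
  fixes \<phi> :: "nat \<Rightarrow> complex" and w T \<Lambda> :: real and m n :: nat
  assumes n: "n > 0" and m: "m > 0" and w: "w > 0" and T: "T > 0" and Y: "finite Y" "Y \<subseteq> {0..<1}"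
    and dense: "\<And>j. j < m \<Longrightarrow> \<exists>y. real j / m \<le> y \<and> y + 2 * real n * w < real j / m + 1 / m \<and>
       (\<forall>i::nat. i < n \<longrightarrow> card (Y \<inter> {y + 2 * real i * w..y + 2 * real i * w + w}) \<ge> T)"
    and \<Lambda>: "(2 / (m * w)) ^ (n - 1) / fact (n - 1) \<le> \<Lambda>"
  shows "(\<Sum>k=1..N. (norm (\<phi> k))\<^sup>2) \<le> 2 * \<Lambda>\<^sup>2 * n / (m * T) * (\<Sum>x\<in>Y. (norm (S N \<phi> x))\<^sup>2)
     + 2 * ((n * \<Lambda> + 1) * ((2 * pi * N / m) ^ n / fact (n - 1)))\<^sup>2 * (\<Sum>k=1..N. (norm (\<phi> k))\<^sup>2)"
proof -
  define D where "D = S N (\<lambda>k. (2 * of_real pi * \<i> * of_nat k) ^ n * \<phi> k)"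
  define J where "J j = {real j / m..<real (Suc j) / m}" for j
  define c1 where "c1 = 2 * \<Lambda>\<^sup>2 * n / (m * T)"
  define c2 where "c2 = 2 * ((n * \<Lambda> + 1) * ((1 / m) ^ n / fact (n - 1)))\<^sup>2"
  have Suc: "real j / m + 1 / m = real (Suc j) / m" for j by (simp add: add_divide_distrib)
  have loc: "integral {real j / m..real (Suc j) / m} (\<lambda>x. (norm (S N \<phi> x))\<^sup>2) \<le>
      c1 * (\<Sum>x\<in>Y \<inter> J j. (norm (S N \<phi> x))\<^sup>2)
      + c2 * integral {real j / m..real (Suc j) / m} (\<lambda>x. (norm (D x))\<^sup>2)" if j: "j < m" for j
  proof -
    obtain y where y: "real j / m \<le> y" "y + 2 * real n * w < real j / m + 1 / m"
      "\<And>i::nat. i < n \<Longrightarrow> card (Y \<inter> {y + 2 * real i * w..y + 2 * real i * w + w}) \<ge> T"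
      using dense[OF j] by blast
    show ?thesis
      using sampling_on_interval[where a = "real j / m" and h = "1 / m" and y = y and N = N and \<phi> = \<phi>,
          OF n w T _ Y(1) y, of \<Lambda>] \<Lambda>
      unfolding Suc D_def J_def c1_def c2_def by simp
  qed
  have cont: "continuous_on UNIV (\<lambda>x. (norm (S N c x))\<^sup>2)" for c
    by (intro continuous_intros)
  have int: "integral {0..1} (\<lambda>x. (norm (S N c x))\<^sup>2) = (\<Sum>k=1..N. (norm (c k))\<^sup>2)" for c
    using parseval_S by (rule integral_unique)
  have nodes: "(\<Sum>j<m. \<Sum>x\<in>Y \<inter> J j. (norm (S N \<phi> x))\<^sup>2) \<le> (\<Sum>x\<in>Y. (norm (S N \<phi> x))\<^sup>2)"
  proof -
    have disj: "J i \<inter> J j = {}" if "i < j" for i j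
    proof -
      have "real (Suc i) / m \<le> real j / m" using that by (intro divide_right_mono) auto
      then show ?thesis unfolding J_def by auto
    qed
    have "(\<Sum>j<m. \<Sum>x\<in>Y \<inter> J j. (norm (S N \<phi> x))\<^sup>2) = (\<Sum>x\<in>(\<Union>j<m. Y \<inter> J j). (norm (S N \<phi> x))\<^sup>2)"
    proof (rule sum.UNION_disjoint[symmetric])
      show "\<forall>i\<in>{..<m}. \<forall>j\<in>{..<m}. i \<noteq> j \<longrightarrow> Y \<inter> J i \<inter> (Y \<inter> J j) = {}"
      proof (intro ballI impI)
        fix i j :: nat assume "i \<noteq> j"
        then show "Y \<inter> J i \<inter> (Y \<inter> J j) = {}"
          using disj[of i j] disj[of j i] by (cases i j rule: linorder_cases) auto
      qed
    qed (use Y in auto)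
    also have "\<dots> \<le> (\<Sum>x\<in>Y. (norm (S N \<phi> x))\<^sup>2)" using Y by (intro sum_mono2) auto
    finally show ?thesis .
  qed
  have "(\<Sum>k=1..N. (norm (\<phi> k))\<^sup>2) = (\<Sum>j<m. integral {real j / m..real (Suc j) / m} (\<lambda>x. (norm (S N \<phi> x))\<^sup>2))"
    unfolding int[symmetric] by (rule integral_split_equal_parts[OF m cont])
  also have "\<dots> \<le> (\<Sum>j<m. c1 * (\<Sum>x\<in>Y \<inter> J j. (norm (S N \<phi> x))\<^sup>2)
      + c2 * integral {real j / m..real (Suc j) / m} (\<lambda>x. (norm (D x))\<^sup>2))"
    using loc by (intro sum_mono) auto
  also have "\<dots> = c1 * (\<Sum>j<m. \<Sum>x\<in>Y \<inter> J j. (norm (S N \<phi> x))\<^sup>2)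
      + c2 * (\<Sum>j<m. integral {real j / m..real (Suc j) / m} (\<lambda>x. (norm (D x))\<^sup>2))"
    by (simp add: sum.distrib sum_distrib_left)
  also have "(\<Sum>j<m. integral {real j / m..real (Suc j) / m} (\<lambda>x. (norm (D x))\<^sup>2)) = integral {0..1} (\<lambda>x. (norm (D x))\<^sup>2)"
    unfolding D_def by (rule integral_split_equal_parts[OF m cont, symmetric])
  also have "c1 * (\<Sum>j<m. \<Sum>x\<in>Y \<inter> J j. (norm (S N \<phi> x))\<^sup>2) + c2 * integral {0..1} (\<lambda>x. (norm (D x))\<^sup>2)
      \<le> c1 * (\<Sum>x\<in>Y. (norm (S N \<phi> x))\<^sup>2)
        + c2 * ((2 * pi * N) ^ (2 * n) * (\<Sum>k=1..N. (norm (\<phi> k))\<^sup>2))"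
    using nodes T bernstein_L2[of n \<phi> N] unfolding D_def int c1_def c2_def
    by (intro add_mono mult_left_mono) auto
  also have "c2 * ((2 * pi * N) ^ (2 * n) * (\<Sum>k=1..N. (norm (\<phi> k))\<^sup>2)) =
      2 * ((n * \<Lambda> + 1) * ((2 * pi * N / m) ^ n / fact (n - 1)))\<^sup>2 * (\<Sum>k=1..N. (norm (\<phi> k))\<^sup>2)"
    unfolding c2_def by (simp add: power_mult_distrib power_divide power_mult mult.commute flip: power_mult)
  finally show ?thesis unfolding c1_def .
qed

section \<open>The lower bound for the large sieve\<close>

text \<open>For \<open>Q \<ge> 1\<close> the point \<open>0\<close> does not belong to the shell, so every point in \<open>{0..<1}\<close> comes from a totative.\<close>
lemma farey_shell_sum_le:
  fixes g :: "real \<Rightarrow> real"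
  assumes Q: "Q \<ge> 1" and g: "\<And>x. g x \<ge> 0"
  shows "sum g (farey_shell Q \<inter> {0..<1}) \<le>
    (\<Sum>q\<in>{q::nat. q > 0 \<and> 1 < real q / Q \<and> real q / Q \<le> 2}. \<Sum>a\<in>totatives q. g (real a / real q))"
proof -
  define A where "A = {q::nat. q > 0 \<and> 1 < real q / Q \<and> real q / Q \<le> 2}"
  have A: "q \<in> A \<longleftrightarrow> Q < real q \<and> real q \<le> 2 * Q" for q
    using Q unfolding A_def by (auto simp: field_simps)
  have "A \<subseteq> {..nat \<lfloor>2 * Q\<rfloor>}" using Q by (auto simp: A le_nat_iff le_floor_iff)
  then have finA: "finite A" by (rule finite_subset) simp
  have sub: "farey_shell Q \<inter> {0..<1} \<subseteq> (\<lambda>(q, a). real a / real q) ` Sigma A totatives"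
  proof
    fix x assume x: "x \<in> farey_shell Q \<inter> {0..<1}"
    then obtain a q :: int where aq: "coprime a q" "Q < q" "q \<le> 2 * Q" "x = a / q"
      by (auto simp: farey_shell_def)
    have q: "q > 1" using aq(2) Q by linarith
    have "a \<ge> 0" "a < q" using x aq(4) q by (auto simp: field_simps zero_le_divide_iff)
    moreover have "a \<noteq> 0" using aq(1) q by auto
    ultimately have a: "a > 0" "a < q" by auto
    have "coprime (nat a) (nat q)" using aq(1) a q by (simp add: coprime_int_iff[symmetric])
    then have "nat a \<in> totatives (nat q)" using a q by (auto simp: totatives_def)
    moreover have "nat q \<in> A" using aq q by (simp add: A)
    moreover have "x = real (nat a) / real (nat q)" using aq(4) a q by simp
    ultimately show "x \<in> (\<lambda>(q, a). real a / real q) ` Sigma A totatives"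
      by (intro image_eqI[of _ _ "(nat q, nat a)"]) auto
  qed
  have "sum g (farey_shell Q \<inter> {0..<1}) \<le> sum g ((\<lambda>(q, a). real a / real q) ` Sigma A totatives)"
    using sub finA g by (intro sum_mono2) auto
  also have "\<dots> \<le> sum (g \<circ> (\<lambda>(q, a). real a / real q)) (Sigma A totatives)"
    using finA g by (intro sum_image_le) auto
  also have "\<dots> = (\<Sum>q\<in>A. \<Sum>a\<in>totatives q. g (real a / real q))"
    using finA by (subst sum.Sigma) (auto simp: o_def case_prod_beta)
  finally show ?thesis unfolding A_def .
qed

text \<open>Here \<open>128 n\<close> is an upper bound for twice the ratio of the length of an interval, at most \<open>16/Q\<close>, to
the separation \<open>1/(4 n Q)\<close> of the nodes; and \<open>384 = 128 * 3\<close>, with \<open>3\<close> in place of \<open>exp 1\<close>.\<close>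
lemma lebesgue_constant_bound:
  fixes n :: nat
  assumes "n > 0"
  shows "(128 * real n) ^ (n - 1) / fact (n - 1) \<le> 384 ^ n"
proof -
  have n: "fact n = real n * fact (n - 1)" "(128 * real n) ^ n = 128 * real n * (128 * real n) ^ (n - 1)"
    using assms by (cases n; simp)+
  have "0 \<le> (128 * real n) ^ (n - 1) / fact (n - 1)" by simp
  then have "(128 * real n) ^ (n - 1) / fact (n - 1) \<le> 128 * ((128 * real n) ^ (n - 1) / fact (n - 1))"
    by linarith
  also have "\<dots> = (128 * real n) ^ n / fact n" using assms n by simp
  also have "\<dots> = 128 ^ n * (real n ^ n / fact n)" by (simp add: power_mult_distrib)
  also have "\<dots> \<le> 128 ^ n * 3 ^ n" using power_self_div_fact_le[of n] by (intro mult_left_mono) auto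
  also have "\<dots> = 384 ^ n" by (simp flip: power_mult_distrib)
  finally show ?thesis .
qed

text \<open>The constant \<open>2 ^ 23\<close> is chosen so that \<open>384 * 101 * 3 / 2 ^ 23 \<le> 1/64\<close>: the factorial then beats the
Lebesgue constant \<open>384 ^ n\<close> and the power of \<open>z\<close> together, with a geometric factor to spare for
\<open>n\<^sup>2\<close>.\<close>
lemma taylor_error_bound:
  fixes n :: nat and z :: real
  assumes n: "n > 0" and z: "0 \<le> z" "z \<le> 101 * real n / 2 ^ 23"
  shows "2 * ((real n * 384 ^ n + 1) * (z ^ n / fact (n - 1)))\<^sup>2 \<le> 1 / 2"
proof -
  have fact_n: "fact n = real n * fact (n - 1)" using n by (cases n) simp_all
  have n2: "(real n)\<^sup>2 \<le> 4 ^ n"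
  proof -
    have "real n \<le> 2 ^ n" using less_exp[of n] by (metis less_imp_le of_nat_le_iff of_nat_numeral of_nat_power)
    then have "(real n)\<^sup>2 \<le> (2 ^ n)\<^sup>2" by (intro power_mono) auto
    also have "\<dots> = 4 ^ n" by (simp add: power2_eq_square flip: power_mult_distrib)
    finally show ?thesis .
  qed
  define E where "E = (real n * 384 ^ n + 1) * (z ^ n / fact (n - 1))"
  have "1 \<le> real n * 384 ^ n" using n by (simp add: mult_ge1_I)
  then have "E \<le> (2 * n * 384 ^ n) * (z ^ n / fact (n - 1))"
    unfolding E_def using z by (intro mult_right_mono) auto
  also have "\<dots> \<le> (2 * n * 384 ^ n) * ((101 * real n / 2 ^ 23) ^ n / fact (n - 1))"
    using z by (intro mult_left_mono divide_right_mono power_mono) auto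
  also have "(101 * real n / 2 ^ 23) ^ n / fact (n - 1) = (101 / 2 ^ 23) ^ n * (n * (real n ^ n / fact n))"
    using n unfolding fact_n by (simp add: power_mult_distrib power_divide)
  also have "2 * n * 384 ^ n * \<dots> \<le> 2 * n * 384 ^ n * ((101 / 2 ^ 23) ^ n * (n * 3 ^ n))"
    using mult_left_mono[OF power_self_div_fact_le, of "real n"] by (intro mult_left_mono) auto
  also have "\<dots> = 2 * (real n)\<^sup>2 * (384 * (101 / 2 ^ 23) * 3) ^ n"
    unfolding power_mult_distrib by (simp add: power2_eq_square)
  also have "\<dots> \<le> 2 * 4 ^ n * (1 / 64) ^ n"
    using n2 by (intro mult_mono power_mono) auto
  also have "\<dots> = 2 * (1 / 16) ^ n" by (simp flip: power_mult_distrib add: mult.assoc)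
  also have "\<dots> \<le> 2 * (1 / 16) ^ 1" using n by (intro mult_left_mono power_decreasing) auto
  finally have "E \<le> 1 / 8" by simp
  moreover have "E \<ge> 0" unfolding E_def using z by simp
  ultimately have "E\<^sup>2 \<le> (1 / 8)\<^sup>2" by (intro power_mono)
  then have "2 * E\<^sup>2 \<le> 1 / 2" by (simp add: power_divide)
  then show ?thesis unfolding E_def .
qed

text \<open>Apply \<open>sampling_inequality\<close> with intervals of length between \<open>8/Q\<close> and \<open>16/Q\<close>: long enough for
\<open>farey_shell_well_distributed\<close>, and short enough for \<open>2 pi N / m\<close> to be at most \<open>101 N / Q\<close>.\<close>
lemma farey_shell_lower_bound:
  fixes \<phi> :: "nat \<Rightarrow> complex" and Q :: real and n N :: nat
  assumes n: "n > 0" and Q: "Q \<ge> 2 ^ 13 * real n ^ 3" and nN: "real n \<ge> 2 ^ 23 * N / Q"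
  shows "Q\<^sup>2 / (2 ^ 19 * real n ^ 4 * 384 ^ (2 * n)) * (\<Sum>k=1..N. (norm (\<phi> k))\<^sup>2)
    \<le> (\<Sum>x\<in>farey_shell Q \<inter> {0..<1}. (norm (S N \<phi> x))\<^sup>2)"
proof -
  have "real n ^ 3 \<ge> 1" using n by simp
  then have Q16: "Q \<ge> 16" using Q by simp
  define m where "m = nat \<lfloor>Q / 8\<rfloor>"
  have m: "real m \<le> Q / 8" "real m \<ge> Q / 16"
  proof -
    have "real m = of_int \<lfloor>Q / 8\<rfloor>" unfolding m_def using Q16 by simp
    moreover have "of_int \<lfloor>Q / 8\<rfloor> \<le> Q / 8" "of_int \<lfloor>Q / 8\<rfloor> \<ge> Q / 8 - 1" by linarith+
    ultimately show "real m \<le> Q / 8" "real m \<ge> Q / 16" using Q16 by linarith+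
  qed
  have m0: "m > 0" using m(2) Q16 by (intro gr0I) simp
  define w where "w = 1 / (4 * real n * Q)"
  define T where "T = Q / (2 ^ 13 * real n ^ 3)"
  define Y where "Y = farey_shell Q \<inter> {0..<1}"
  define M where "M = (\<Sum>k=1..N. (norm (\<phi> k))\<^sup>2)"
  define F where "F = (\<Sum>x\<in>Y. (norm (S N \<phi> x))\<^sup>2)"
  have w: "w > 0" "2 * real n * w = 1 / (2 * Q)" unfolding w_def using n Q16 by auto
  have T: "T > 0" unfolding T_def using n Q16 by simp
  have Y: "finite Y" "Y \<subseteq> {0..<1}"
  proof -
    show "finite Y"
      unfolding Y_def by (rule finite_subset[OF _ finite_farey_shell[of Q 0 1]]) (use Q16 in auto)
  qed (simp add: Y_def)
  have dense: "\<exists>y. real j / m \<le> y \<and> y + 2 * real n * w < real j / m + 1 / m \<and>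
      (\<forall>i::nat. i < n \<longrightarrow> card (Y \<inter> {y + 2 * real i * w..y + 2 * real i * w + w}) \<ge> T)"
    if j: "j < m" for j
  proof -
    have "1 / m \<ge> 8 / Q" using m(1) m0 Q16 by (simp add: field_simps)
    then obtain y where y: "real j / m \<le> y" "y + 1 / (2 * Q) < real j / m + 1 / m"
      "\<And>z. y \<le> z \<Longrightarrow> z + w \<le> y + 1 / (2 * Q) \<Longrightarrow> card (farey_shell Q \<inter> {z..z + w}) \<ge> T"
      using farey_shell_well_distributed[of n Q "1 / m" "real j / m"] n Q
      unfolding T_def w_def by auto
    have "card (Y \<inter> {y + 2 * real i * w..y + 2 * real i * w + w}) \<ge> T" if i: "i < n" for i :: nat
    proof -
      have "(2 * real i + 1) * w \<le> 2 * real n * w" using i w by (intro mult_right_mono) auto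
      then have hi: "2 * real i * w + w \<le> 1 / (2 * Q)" using w by (simp add: algebra_simps)
      have lo: "2 * real i * w \<ge> 0" using w by simp
      have "real j / m + 1 / m \<le> 1" using j m0 by (simp add: field_simps)
      moreover have "real j / m \<ge> 0" by simp
      ultimately have "x \<in> {0..<1}" if "x \<in> {y + 2 * real i * w..y + 2 * real i * w + w}" for x
        using that y(1,2) hi lo unfolding atLeastAtMost_iff atLeastLessThan_iff by linarith
      then have "Y \<inter> {y + 2 * real i * w..y + 2 * real i * w + w}
          = farey_shell Q \<inter> {y + 2 * real i * w..y + 2 * real i * w + w}"
        unfolding Y_def by blast
      moreover have "y \<le> y + 2 * real i * w" using lo by linarith
      moreover have "y + 2 * real i * w + w \<le> y + 1 / (2 * Q)" using hi by linarith
      ultimately show ?thesis using y(3)[of "y + 2 * real i * w"] by (simp only:)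
    qed
    then show ?thesis using y(1,2) unfolding w(2) by blast
  qed
  have \<Lambda>: "(2 / (m * w)) ^ (n - 1) / fact (n - 1) \<le> 384 ^ n"
  proof -
    have "2 / (m * w) = 8 * real n * (Q / m)" unfolding w_def by simp
    also have "\<dots> \<le> 8 * real n * 16" using m m0 by (intro mult_left_mono) (auto simp: field_simps)
    finally have "2 / (m * w) \<le> 128 * real n" by simp
    then have "(2 / (m * w)) ^ (n - 1) / fact (n - 1) \<le> (128 * real n) ^ (n - 1) / fact (n - 1)"
      using w m0 by (intro divide_right_mono power_mono) auto
    also have "\<dots> \<le> 384 ^ n" by (rule lebesgue_constant_bound[OF n])
    finally show ?thesis .
  qed
  have z: "2 * pi * N / m \<le> 101 * real n / 2 ^ 23"
  proof -
    have "2 * pi * N / m \<le> 2 * pi * N / (Q / 16)"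
      using m m0 Q16 by (intro divide_left_mono mult_pos_pos) auto
    also have "\<dots> = 32 * pi * (N / Q)" using Q16 by (simp add: field_simps)
    also have "\<dots> \<le> 101 * (N / Q)" using pi_less_4 pi_approx Q16 by (intro mult_right_mono) auto
    also have "\<dots> \<le> 101 * (real n / 2 ^ 23)" using nN by (intro mult_left_mono) (auto simp: field_simps)
    finally show ?thesis by simp
  qed
  have M0: "M \<ge> 0" unfolding M_def by (intro sum_nonneg) simp
  have "M \<le> 2 * (384 ^ n)\<^sup>2 * real n / (m * T) * F
      + 2 * ((real n * 384 ^ n + 1) * ((2 * pi * N / m) ^ n / fact (n - 1)))\<^sup>2 * M"
    unfolding M_def F_def by (rule sampling_inequality[OF n m0 w(1) T Y dense \<Lambda>])
  also have "\<dots> \<le> 2 * (384 ^ n)\<^sup>2 * real n / (m * T) * F + 1 / 2 * M"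
    using taylor_error_bound[OF n _ z] M0 by (intro add_left_mono mult_right_mono) auto
  finally have "M \<le> 4 * (384 ^ n)\<^sup>2 * real n / (m * T) * F" by simp
  then have "(m * T) / (4 * (384 ^ n)\<^sup>2 * real n) * M \<le> F"
    using m0 T n by (simp add: field_simps)
  moreover have "Q\<^sup>2 / (2 ^ 19 * real n ^ 4 * 384 ^ (2 * n)) = (Q / 16 * T) / (4 * (384 ^ n)\<^sup>2 * real n)"
    unfolding T_def using n by (simp add: power2_eq_square power_mult power4_eq_xxxx power3_eq_cube power_mult_distrib flip: power_add mult_2)
  moreover have "(Q / 16 * T) / (4 * (384 ^ n)\<^sup>2 * real n) * M \<le> (m * T) / (4 * (384 ^ n)\<^sup>2 * real n) * M"
    using m T M0 by (intro mult_right_mono divide_right_mono) auto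
  ultimately show ?thesis unfolding M_def F_def Y_def by simp
qed

lemma loss_le_exp:
  fixes n :: nat
  assumes "n > 0"
  shows "2 ^ 19 * real n ^ 4 * 384 ^ (2 * n) \<le> exp (41 * real n)"
proof -
  have "real n \<le> 2 ^ n" using less_exp[of n] by (metis less_imp_le of_nat_le_iff of_nat_numeral of_nat_power)
  then have "real n ^ 4 \<le> (2 ^ n) ^ 4" by (intro power_mono) auto
  moreover have "(2::real) ^ 19 \<le> (2 ^ 19) ^ n" using assms by (intro self_le_power) auto
  ultimately have "2 ^ 19 * real n ^ 4 * 384 ^ (2 * n) \<le> (2 ^ 19) ^ n * (2 ^ n) ^ 4 * 384 ^ (2 * n)"
    by (intro mult_mono) auto
  also have "\<dots> = (2 ^ 19 * 2 ^ 4 * 384 ^ 2) ^ n"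
  proof -
    have "((2::real) ^ n) ^ 4 = (2 ^ 4) ^ n" "(384::real) ^ (2 * n) = (384 ^ 2) ^ n"
      by (simp_all only: power_mult mult.commute flip: power_mult)
    then show ?thesis by (simp only: power_mult_distrib)
  qed
  also have "\<dots> \<le> (2 ^ 41) ^ n" by (intro power_mono) auto
  also have "\<dots> \<le> (exp 1 ^ 41) ^ n"
    using exp_ge_add_one_self[of 1] by (intro power_mono) auto
  also have "\<dots> = exp (41 * real n)"
    by (simp flip: exp_of_nat_mult power_mult)
  finally show ?thesis .
qed

text \<open>The constant is chosen larger than \<open>41 * 2 ^ 23\<close> to absorb the rounding of \<open>n\<close> to an integer. It gives
\<open>41 n \<le> c N / Q \<le> sqrt (ln N)\<close>, which provides both the exponential bound for the loss and the lower
bound for \<open>Q\<close> in terms of \<open>n ^ 3\<close>.\<close>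
theorem theorem1p1:
  "\<exists>c::real. c > 0 \<and>
     (\<exists>N0::nat. \<forall>N\<ge>N0. \<forall>Q::real. \<forall>\<phi> :: nat \<Rightarrow> complex.
        Q \<in> {c * real N / sqrt (ln (real N)) .. 20 * real N} \<longrightarrow>
        (\<Sum>q\<in>{q::nat. q > 0 \<and> 1 < real q / Q \<and> real q / Q \<le> 2}.
           \<Sum>a\<in>totatives q. (norm (S N \<phi> (real a / real q)))\<^sup>2)
        \<ge> Q\<^sup>2 * exp (- c * real N / Q) * (\<Sum>m=1..N. (norm (\<phi> m))\<^sup>2))"
proof -
  define c :: real where "c = 50 * 2 ^ 23"
  have "eventually (\<lambda>N::nat. 2 ^ 13 * sqrt (ln (real N)) ^ 3 \<le> real N / sqrt (ln (real N)) \<and> N \<ge> 3) at_top"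
    by (intro eventually_conj eventually_ge_at_top) real_asymp
  then obtain N0 where N0: "\<And>N. N \<ge> N0 \<Longrightarrow>
      2 ^ 13 * sqrt (ln (real N)) ^ 3 \<le> real N / sqrt (ln (real N)) \<and> N \<ge> 3"
    unfolding eventually_at_top_linorder by blast
  have "(\<Sum>q\<in>{q::nat. q > 0 \<and> 1 < real q / Q \<and> real q / Q \<le> 2}.
           \<Sum>a\<in>totatives q. (norm (S N \<phi> (real a / real q)))\<^sup>2)
        \<ge> Q\<^sup>2 * exp (- c * real N / Q) * (\<Sum>m=1..N. (norm (\<phi> m))\<^sup>2)"
    if N: "N \<ge> N0" and Q: "Q \<in> {c * real N / sqrt (ln (real N)) .. 20 * real N}" for N Q \<phi>
  proof -
    define s where "s = sqrt (ln (real N))"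
    have N3: "N \<ge> 3" and large: "2 ^ 13 * s ^ 3 \<le> real N / s" using N0[OF N] unfolding s_def by auto
    have s: "s > 0" unfolding s_def using N3 by simp
    have Qlo: "c * real N / s \<le> Q" and Qhi: "Q \<le> 20 * real N" using Q unfolding s_def by auto
    have "c * real N / s > 0" using s N3 unfolding c_def by simp
    then have Q0: "Q > 0" using Qlo by linarith
    define n where "n = nat \<lceil>2 ^ 23 * real N / Q\<rceil>"
    have pos: "2 ^ 23 * real N / Q > 0" using N3 Q0 by simp
    have n: "n > 0" "real n \<ge> 2 ^ 23 * real N / Q" "real n \<le> 2 ^ 23 * real N / Q + 1"
      
    proof -
      show "n > 0" using pos unfolding n_def by simp
      have "real n = of_int \<lceil>2 ^ 23 * real N / Q\<rceil>" unfolding n_def using pos by simp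
      then show "real n \<ge> 2 ^ 23 * real N / Q" "real n \<le> 2 ^ 23 * real N / Q + 1" by linarith+
    qed
    have "1 \<le> 20 * real N / Q" using Qhi Q0 by (simp add: field_simps)
    then have n_le: "41 * real n \<le> c * real N / Q" using n(3) unfolding c_def by simp
    have "c * real N / Q \<le> s" using Qlo Q0 s by (simp add: field_simps)
    then have "real n \<le> s" using n_le by linarith
    then have "2 ^ 13 * real n ^ 3 \<le> 2 ^ 13 * s ^ 3" by (intro mult_left_mono power_mono) auto
    also have "\<dots> \<le> real N / s" by (rule large)
    also have "\<dots> \<le> c * real N / s" using s unfolding c_def by (intro divide_right_mono) auto
    finally have Qn: "Q \<ge> 2 ^ 13 * real n ^ 3" using Qlo by linarith
    have "real n ^ 3 \<ge> 1" using n by simp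
    then have Q1: "Q \<ge> 1" using Qn by simp
    have "2 ^ 19 * real n ^ 4 * 384 ^ (2 * n) \<le> exp (41 * real n)" using loss_le_exp n by blast
    also have "\<dots> \<le> exp (c * real N / Q)" using n_le by simp
    finally have "Q\<^sup>2 / exp (c * real N / Q) \<le> Q\<^sup>2 / (2 ^ 19 * real n ^ 4 * 384 ^ (2 * n))"
      using n by (intro divide_left_mono) auto
    then have "Q\<^sup>2 * exp (- c * real N / Q) \<le> Q\<^sup>2 / (2 ^ 19 * real n ^ 4 * 384 ^ (2 * n))"
      by (simp add: exp_minus field_simps)
    then have "Q\<^sup>2 * exp (- c * real N / Q) * (\<Sum>m=1..N. (norm (\<phi> m))\<^sup>2) \<le>
        Q\<^sup>2 / (2 ^ 19 * real n ^ 4 * 384 ^ (2 * n)) * (\<Sum>m=1..N. (norm (\<phi> m))\<^sup>2)"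
      by (intro mult_right_mono sum_nonneg) auto
    also have "\<dots> \<le> (\<Sum>x\<in>farey_shell Q \<inter> {0..<1}. (norm (S N \<phi> x))\<^sup>2)"
      using n Qn by (intro farey_shell_lower_bound) auto
    also have "\<dots> \<le> (\<Sum>q\<in>{q::nat. q > 0 \<and> 1 < real q / Q \<and> real q / Q \<le> 2}.
        \<Sum>a\<in>totatives q. (norm (S N \<phi> (real a / real q)))\<^sup>2)"
      using Q1 by (intro farey_shell_sum_le) auto
    finally show ?thesis .
  qed
  moreover have "c > 0" unfolding c_def by simp
  ultimately show ?thesis by blast
qed

end
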